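(* Assume: (1) $(X_i,Y_i)_{i=1}^n$ are i.i.d. copies of $(X,Y)$, where $Y=\langle\beta,X\rangle+\varepsilon$ with $\mathbb{E}[\varepsilon X]=0$, $\mathbb{E}[X]=0$, $\mathbb{E}\|X\|^4<\infty$ and $\mathbb{E}[\varepsilon^2\mid X]\le\sigma^2<\infty$; (2) the covariance operator $K=\mathbb{E}[X\otimes X]$ has no zero eigenvalues; (3) for some $\mu\ge1$ and $R,C>0$, $\sum_{j\ge1}\langle\beta,v_j\rangle^2/\lambda_j^{2\mu}\le R^2$ and $\sum_{j\ge1}\lambda_j\le C$; (4) the number of PLS components is selected by the early stopping rule $$\hat m=\min\left\{m\ge0:\ \left\|\hat r-\hat K\hat\beta_m\right\|\le\tau\sigma\sqrt{\frac{2\mathbb{E}\|X\|^2}{\delta n}}\right\}$$ for some $\tau>1$ and $\delta\in(0,1)$ with $\delta\ge e/n$. Then with probability at least $1-\delta$ the following hold, with constants in $O(\cdot)$ for $\hat m$ not depending on $n$ or $\delta$: (i) if $\lambda_j=O(j^{-2\kappa})$ for some $\kappa>0$, then $\hat m=O\left((n\delta)^{\frac{1}{4(\kappa+1)(\mu+1)}}\right)$; (ii) if $\lambda_j=O(q^j)$ for some $q\in(0,1)$, then $\hat m=O\left(\log(n\delta)\right)$.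
   Context: $(\mathbb{H},\langle\cdot,\cdot\rangle)$ is a separable real Hilbert space with norm $\|\cdot\|$; $X,\beta\in\mathbb{H}$, $Y,\varepsilon\in\mathbb{R}$. For $x\in\mathbb{H}$, $(x\otimes x)b=\langle x,b\rangle x$. $K=\mathbb{E}[X\otimes X]=\sum_{j\ge1}\lambda_jv_j\otimes v_j$, with eigenvalues $\lambda_1\ge\lambda_2\ge\dots\ge0$ and orthonormal eigenvectors $v_j$. Sample quantities: $\hat r=\frac1n\sum_{i=1}^nY_iX_i$, $\hat K=\frac1n\sum_{i=1}^nX_i\otimes X_i$. PLS estimator: $\hat\beta_0=0$ and, for $m\ge1$, $\hat\beta_m$ is the minimizer of $\|\hat r-\hat Kb\|^2$ over $b$ in the Krylov subspace $\mathbb{H}_m=\mathrm{span}\{\hat r,\hat K\hat r,\dots,\hat K^{m-1}\hat r\}$. The level $\delta$ is allowed to depend on $n$; $e$ is Euler's number.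
   Formalization: The noise level σ is assumed strictly positive; for σ = 0 the stopping threshold is zero, and in noiseless infinite-dimensional models the number of components is typically n, so the stated bounds fail. *)

theory Defs
  imports "HOL-Probability.Probability" "HOL-Library.Landau_Symbols"
begin

(* (x \<otimes> x) b *)
definition rank_one :: "'a::real_inner \<Rightarrow> 'a \<Rightarrow> 'a" where
  "rank_one x b = (x \<bullet> b) *\<^sub>R x"

(* E[X \<otimes> X], defined pointwise: the space of bounded operators is not separable, so
   the Bochner integral of the operator-valued map itself is not available. *)
definition cov_op ::
  "'p measure \<Rightarrow> ('p \<Rightarrow> 'a::{real_inner,banach,second_countable_topology}) \<Rightarrow> 'a \<Rightarrow> 'a" where
  "cov_op P X b = (\<integral>\<omega>. rank_one (X \<omega>) b \<partial>P)"

definition is_eigenvalue :: "('a::real_vector \<Rightarrow> 'a) \<Rightarrow> real \<Rightarrow> bool" where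
  "is_eigenvalue T l \<longleftrightarrow> (\<exists>b. b \<noteq> 0 \<and> T b = l *\<^sub>R b)"

(* T = (\<Sum>j\<in>J. lam j v_j \<otimes> v_j).  The index set J is {1, 2, ...}, or {1, ..., N} so that
   finite-dimensional spaces are not excluded.  Outside J the eigenvalue sequence is padded
   with zeros, so that it is a sequence on all of nat to which Landau symbols apply; v is
   unconstrained there. *)
definition spectral_decomp ::
  "('a::real_inner \<Rightarrow> 'a) \<Rightarrow> nat set \<Rightarrow> (nat \<Rightarrow> real) \<Rightarrow> (nat \<Rightarrow> 'a) \<Rightarrow> bool" where
  "spectral_decomp T J lam v \<longleftrightarrow>
     (J = {1..} \<or> (\<exists>N. J = {1..N})) \<and>
     (\<forall>i\<in>J. \<forall>j\<in>J. v i \<bullet> v j = (if i = j then 1 else 0)) \<and>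
     (\<forall>i\<in>J. \<forall>j\<in>J. i \<le> j \<longrightarrow> lam j \<le> lam i) \<and>
     (\<forall>j\<in>J. 0 \<le> lam j) \<and>
     (\<forall>j. j \<notin> J \<longrightarrow> lam j = 0) \<and>
     (\<forall>b. ((\<lambda>j. lam j *\<^sub>R rank_one (v j) b) has_sum T b) J)"

(* The pairs (Xs i, Ys i), i = 1, ..., n, on the probability space M are i.i.d. copies of
   the pair (X, Y) on P. *)
definition iid_copies ::
  "'b measure \<Rightarrow> nat \<Rightarrow> (nat \<Rightarrow> 'b \<Rightarrow> 'a) \<Rightarrow> (nat \<Rightarrow> 'b \<Rightarrow> real) \<Rightarrow>
   'p measure \<Rightarrow> ('p \<Rightarrow> 'a::{real_inner,banach,second_countable_topology}) \<Rightarrow> ('p \<Rightarrow> real) \<Rightarrow> bool" where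
  "iid_copies M n Xs Ys P X Y \<longleftrightarrow>
     prob_space.indep_vars M (\<lambda>_. borel) (\<lambda>i \<omega>. (Xs i \<omega>, Ys i \<omega>)) {1..n} \<and>
     (\<forall>i\<in>{1..n}. distr M borel (\<lambda>\<omega>. (Xs i \<omega>, Ys i \<omega>)) = distr P borel (\<lambda>\<omega>. (X \<omega>, Y \<omega>)))"

(* In the following, x i and y i (i = 1, ..., n) are the observed data. *)

definition emp_r :: "nat \<Rightarrow> (nat \<Rightarrow> 'a::real_inner) \<Rightarrow> (nat \<Rightarrow> real) \<Rightarrow> 'a" where
  "emp_r n x y = (1 / real n) *\<^sub>R (\<Sum>i=1..n. y i *\<^sub>R x i)"

definition emp_K :: "nat \<Rightarrow> (nat \<Rightarrow> 'a::real_inner) \<Rightarrow> 'a \<Rightarrow> 'a" where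
  "emp_K n x b = (1 / real n) *\<^sub>R (\<Sum>i=1..n. rank_one (x i) b)"

definition krylov :: "nat \<Rightarrow> (nat \<Rightarrow> 'a::real_inner) \<Rightarrow> (nat \<Rightarrow> real) \<Rightarrow> nat \<Rightarrow> 'a set" where
  "krylov n x y m = span {(emp_K n x ^^ k) (emp_r n x y) | k. k < m}"

(* The minimizer exists and is unique because emp_r lies in the finite-dimensional range of
   the self-adjoint operator emp_K, on which emp_K is injective. *)
definition pls :: "nat \<Rightarrow> (nat \<Rightarrow> 'a::real_inner) \<Rightarrow> (nat \<Rightarrow> real) \<Rightarrow> nat \<Rightarrow> 'a" where
  "pls n x y m =
     (if m = 0 then 0
      else arg_min (\<lambda>b. (norm (emp_r n x y - emp_K n x b))\<^sup>2) (\<lambda>b. b \<in> krylov n x y m))"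

definition pls_stop ::
  "nat \<Rightarrow> (nat \<Rightarrow> 'a::real_inner) \<Rightarrow> (nat \<Rightarrow> real) \<Rightarrow> real \<Rightarrow> nat" where
  "pls_stop n x y t =
     (LEAST m. norm (emp_r n x y - emp_K n x (pls n x y m)) \<le> t)"

end

theory Submission
  imports Defs "HOL-Computational_Algebra.Polynomial"
begin

text \<open>
  Write \<open>T\<close> for the empirical covariance operator, \<open>K\<close> for the population one, \<open>r\<close> for the
  empirical cross-covariance and \<open>N = n \<delta>\<close>.  All randomness enters through two quantities: the noise
  \<open>r - T \<beta>\<close> and the Hilbert--Schmidt distance \<open>(\<Sum>j. \<parallel>(T - K) v\<^sub>j\<parallel>\<^sup>2)\<^sup>1\<^sup>/\<^sup>2\<close>.  Both are norms of means of
  \<open>n\<close> independent centred vectors, so their second moments are of order \<open>1/n\<close>; Markov's inequality, spending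
  \<open>\<delta>/2\<close> on each, bounds them by \<open>\<Delta> = D0 N\<^sup>-\<^sup>1\<^sup>/\<^sup>2\<close> and \<open>h = B0 N\<^sup>-\<^sup>1\<^sup>/\<^sup>2\<close>
  (\<open>close_data_event\<close>).  The stopping threshold is \<open>\<tau> \<Delta>\<close>.  The rest is deterministic.

  Minimising the residual over the Krylov space spanned by \<open>m\<close> vectors means minimising \<open>\<parallel>p(T) r\<parallel>\<close> over
  polynomials \<open>p\<close> with \<open>p(0) = 1\<close> and degree at most \<open>m\<close> (\<open>pls_residual_le_op_poly\<close>).  Hence an upper
  bound for the stopping index follows from exhibiting one good polynomial of low degree.  Given a level
  \<open>s \<ge> h\<close>, take \<open>p\<close> to be the product of the factors \<open>1 - x/l\<close> over the eigenvalues \<open>l \<ge> 2s\<close> of \<open>T\<close>,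
  which removes these eigenspaces exactly, and of a power of the \<open>d\<close>-th Fejer polynomial, scaled to
  \<open>[0, 2s]\<close>, which gains a factor \<open>d\<^sup>-\<^sup>2\<close> for each power of \<open>x\<close> (\<open>filter_polynomial\<close>).  Then
  \<open>\<bar>p\<bar> \<le> 1\<close> on the spectrum of \<open>T\<close>, so the noise contributes at most \<open>\<Delta>\<close> to \<open>p(T) r\<close>, and there remain
  \<open>(\<tau> - 1) \<Delta>\<close> for the contribution \<open>p(T) T \<beta>\<close> of the signal.

  Two facts relate \<open>T\<close> to \<open>K\<close>.  Both come from the single inequality
  \<open>\<Sum>\<^sub>u \<Sum>\<^sub>j (u \<bullet> v\<^sub>j)\<^sup>2 (\<lambda>\<^sub>j - l\<^sub>u)\<^sup>2 \<le> h\<^sup>2\<close> for the eigenvectors \<open>u\<close> of \<open>T\<close> (\<open>gap_sum_le\<close>).  First, \<open>T\<close> has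
  at most one eigenvalue above \<open>2s\<close> more than \<open>K\<close> has above \<open>s\<close> (\<open>card_large_eigenvalues_le\<close>), which
  controls the degree of \<open>p\<close>.  Secondly, the source condition \<open>\<beta> = K\<^sup>\<mu> w\<close> may be read with \<open>T\<^sup>\<mu>\<close> in place of
  \<open>K\<^sup>\<mu>\<close> at the cost of \<open>O(h)\<close>, because \<open>x\<^sup>\<mu>\<close> is Lipschitz for \<open>\<mu> \<ge> 1\<close> (\<open>filtered_source_le\<close>).  So
  \<open>p(T) T \<beta>\<close> has norm at most a constant times \<open>(s/d\<^sup>2)\<^sup>\<mu>\<^sup>+\<^sup>1 + (s/d\<^sup>2) h\<close>.

  It remains to choose \<open>s\<close> and \<open>d\<close>.  If \<open>\<lambda>\<^sub>j = O(j\<^sup>-\<^sup>2\<^sup>\<kappa>)\<close>, remove about \<open>k = N\<^sup>\<theta>\<close> eigenvalues, where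
  \<open>\<theta> = 1 / (4 (\<kappa> + 1) (\<mu> + 1))\<close>; then \<open>s\<close> is of order \<open>k\<^sup>-\<^sup>2\<^sup>\<kappa>\<close>, and with \<open>d\<close> a large multiple of \<open>k\<close> the
  term \<open>(s/d\<^sup>2)\<^sup>\<mu>\<^sup>+\<^sup>1\<close> is a small multiple of \<open>k\<^sup>-\<^sup>2\<^sup>(\<^sup>\<kappa>\<^sup>+\<^sup>1\<^sup>)\<^sup>(\<^sup>\<mu>\<^sup>+\<^sup>1\<^sup>)\<close>, that is, of \<open>N\<^sup>-\<^sup>1\<^sup>/\<^sup>2\<close>.  If \<open>\<lambda>\<^sub>j = O(q\<^sup>j)\<close>,
  take \<open>s\<close> of order \<open>N\<close> to the power \<open>-1/(2 (\<mu> + 1))\<close>; only \<open>O(log N)\<close> eigenvalues exceed it and a constant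
  \<open>d\<close> suffices.
\<close>

section \<open>Fejer polynomials and the spectral filter\<close>

text \<open>
  Chebyshev's recursion for \<open>cos (2 n t)\<close>, rewritten for \<open>(1 - cos (2 n t)) / (1 - cos (2 t))\<close> as a polynomial
  in \<open>x = sin\<^sup>2 t\<close>: these are the Fejer kernels \<open>(sin (n t) / sin t)\<^sup>2\<close>.
\<close>

fun fejer :: "nat \<Rightarrow> real poly" where
  "fejer 0 = 0"
| "fejer (Suc 0) = 1"
| "fejer (Suc (Suc n)) = [:2:] + [:2, -4:] * fejer (Suc n) - fejer n"

lemma fejer_sin: "poly (fejer n) ((sin t)\<^sup>2) * (sin t)\<^sup>2 = (sin (real n * t))\<^sup>2"
proof (induction n rule: fejer.induct)
  case (3 n)
  define a where "a = real (Suc n) * t"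
  have e: "real (Suc (Suc n)) * t = a + t" "real n * t = a - t"
    by (simp_all add: a_def algebra_simps)
  have c: "(cos a)\<^sup>2 = 1 - (sin a)\<^sup>2" "(cos t)\<^sup>2 = 1 - (sin t)\<^sup>2"
    by (simp_all add: cos_squared_eq)
  have "poly (fejer (Suc (Suc n))) ((sin t)\<^sup>2) * (sin t)\<^sup>2
      = 2 * (sin t)\<^sup>2 + (2 - 4 * (sin t)\<^sup>2) * (poly (fejer (Suc n)) ((sin t)\<^sup>2) * (sin t)\<^sup>2)
        - poly (fejer n) ((sin t)\<^sup>2) * (sin t)\<^sup>2"
    by (simp add: algebra_simps)
  also have "\<dots> = 2 * (sin t)\<^sup>2 + (2 - 4 * (sin t)\<^sup>2) * (sin a)\<^sup>2 - (sin (a - t))\<^sup>2"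
    using 3 by (simp only: e a_def)
  also have "\<dots> = (sin (a + t))\<^sup>2"
  proof -
    have "(sin (a + t))\<^sup>2 + (sin (a - t))\<^sup>2 = 2 * ((sin a)\<^sup>2 * (cos t)\<^sup>2) + 2 * ((cos a)\<^sup>2 * (sin t)\<^sup>2)"
      by (simp add: sin_add sin_diff power2_eq_square algebra_simps)
    thus ?thesis unfolding c by (simp add: algebra_simps)
  qed
  finally show ?case by (simp only: e)
qed simp_all

lemma poly_fejer_0: "poly (fejer n) 0 = (real n)\<^sup>2"
  by (induction n rule: fejer.induct) (simp_all add: power2_eq_square algebra_simps)

lemma degree_fejer: "degree (fejer n) \<le> n"
proof (induction n rule: fejer.induct)
  case (3 n)
  have "degree ([:2, -4:] * fejer (Suc n)) \<le> Suc (Suc n)"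
    by (rule order.trans[OF degree_mult_le]) (use 3 in simp)
  hence "degree ([:2:] + [:2, -4:] * fejer (Suc n)) \<le> Suc (Suc n)"
    by (intro degree_add_le) simp_all
  thus ?case unfolding fejer.simps using 3 by (intro degree_diff_le) auto
qed simp_all

lemma abs_sin_mult_le: "\<bar>sin (real n * t)\<bar> \<le> real n * \<bar>sin t\<bar>"
proof (induction n)
  case (Suc n)
  have "\<bar>sin (real (Suc n) * t)\<bar> = \<bar>sin (real n * t) * cos t + cos (real n * t) * sin t\<bar>"
    by (simp only: of_nat_Suc distrib_right mult_1 sin_add) (simp add: algebra_simps)
  also have "\<dots> \<le> \<bar>sin (real n * t)\<bar> * \<bar>cos t\<bar> + \<bar>cos (real n * t)\<bar> * \<bar>sin t\<bar>"
    by (metis abs_mult abs_triangle_ineq)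
  also have "\<dots> \<le> \<bar>sin (real n * t)\<bar> * 1 + 1 * \<bar>sin t\<bar>"
    by (intro add_mono mult_mono) auto
  finally show ?case using Suc by (simp add: algebra_simps)
qed simp

text \<open>
  The first two bounds keep the normalised kernel in \<open>[0, 1]\<close>; the third one is the decay \<open>sin\<^sup>2 (n t) \<le> 1\<close>,
  which after division by the value \<open>n\<^sup>2\<close> at zero becomes the gain \<open>1 / n\<^sup>2\<close> of the filter.
\<close>

lemma fejer_bounds:
  assumes "0 \<le> x" "x \<le> 1"
  shows "0 \<le> poly (fejer n) x" "poly (fejer n) x \<le> (real n)\<^sup>2" "x * poly (fejer n) x \<le> 1"
proof -
  have "0 \<le> poly (fejer n) x \<and> poly (fejer n) x \<le> (real n)\<^sup>2 \<and> x * poly (fejer n) x \<le> 1"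
  proof (cases "x = 0")
    case True
    thus ?thesis by (simp add: poly_fejer_0)
  next
    case False
    define t where "t = arcsin (sqrt x)"
    have st: "sin t = sqrt x" unfolding t_def using assms by (subst sin_arcsin) (auto intro: order_trans[of _ 0])
    hence x: "(sin t)\<^sup>2 = x" using assms by simp
    have pos: "x > 0" using False assms by simp
    have eq: "poly (fejer n) x * x = (sin (real n * t))\<^sup>2" using fejer_sin[of n t] x by simp
    have "(sin (real n * t))\<^sup>2 \<le> (real n * \<bar>sin t\<bar>)\<^sup>2"
      using abs_sin_mult_le[of n t] by (metis abs_ge_zero power2_abs power_mono)
    hence "poly (fejer n) x * x \<le> (real n)\<^sup>2 * x" by (simp add: eq power_mult_distrib x)
    moreover have "0 \<le> poly (fejer n) x * x" by (simp add: eq)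
    moreover have "poly (fejer n) x * x \<le> 1"
      unfolding eq by (simp add: abs_square_le_1)
    ultimately show ?thesis using pos by (simp add: mult.commute zero_le_mult_iff mult_le_cancel_right)
  qed
  thus "0 \<le> poly (fejer n) x" "poly (fejer n) x \<le> (real n)\<^sup>2" "x * poly (fejer n) x \<le> 1" by auto
qed

lemma degree_prod_le:
  assumes "finite A"
  shows "degree (prod f A) \<le> (\<Sum>i\<in>A. degree (f i))"
  using assms
  by (induction) (auto intro: order.trans[OF degree_mult_le])

text \<open>
  The polynomial that annihilates the eigenvalues \<open>l u\<close> above \<open>t\<close> and damps the rest of the spectrum.  One
  normalised Fejer polynomial \<open>b\<close> on \<open>[0, t]\<close> satisfies \<open>x b(x) \<le> t / d\<^sup>2\<close>; since \<open>0 \<le> b \<le> 1\<close>, its power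
  \<open>b\<^sup>L\<close> is at most \<open>b\<^sup>a\<close> for every real \<open>a \<le> L\<close>, which yields \<open>x\<^sup>a b\<^sup>L \<le> (t / d\<^sup>2)\<^sup>a\<close>.  The factors \<open>1 - x / l u\<close> do
  no harm, as they lie in \<open>[0, 1]\<close> for \<open>0 \<le> x < t\<close>.
\<close>

lemma filter_polynomial:
  fixes l :: "'u \<Rightarrow> real"
  assumes fin: "finite I" and l: "\<And>u. u \<in> I \<Longrightarrow> t \<le> l u" and t: "0 < t" and d: "1 \<le> d" and L: "1 \<le> L"
  obtains p where "degree p \<le> card I + L * d" "poly p 0 = 1"
    "\<And>u. u \<in> I \<Longrightarrow> poly p (l u) = 0"
    "\<And>x. 0 \<le> x \<Longrightarrow> x < t \<Longrightarrow> \<bar>poly p x\<bar> \<le> 1"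
    "\<And>x a. 0 \<le> x \<Longrightarrow> x < t \<Longrightarrow> 1 \<le> a \<Longrightarrow> a \<le> real L \<Longrightarrow>
       x powr a * \<bar>poly p x\<bar> \<le> (t / (real d)\<^sup>2) powr a"
proof
  define z where "z = (\<Prod>u\<in>I. [:1, - 1 / l u:])"
  \<comment> \<open>normalised to \<open>b(0) = 1\<close> by \<open>fejer d\<close> having the value \<open>d\<^sup>2\<close> at \<open>0\<close>\<close>
  define b where "b = smult (1 / (real d)\<^sup>2) (fejer d \<circ>\<^sub>p [:0, 1 / t:])"
  define p where "p = z * b ^ L"
  have d0: "real d > 0" using d by simp
  have "degree z \<le> (\<Sum>u\<in>I. degree [:1, - 1 / l u:])"
    unfolding z_def by (rule degree_prod_le[OF fin])
  also have "\<dots> \<le> (\<Sum>u\<in>I. 1)" by (intro sum_mono) simp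
  finally have dz: "degree z \<le> card I" by simp
  have db: "degree b \<le> d"
  proof -
    have "degree b \<le> degree (fejer d \<circ>\<^sub>p [:0, 1 / t:])" unfolding b_def by (rule degree_smult_le)
    also have "\<dots> \<le> degree (fejer d)" using degree_pcompose_le[of "fejer d" "[:0, 1 / t:]"] t by simp
    finally show ?thesis using degree_fejer[of d] by simp
  qed
  have "degree (b ^ L) \<le> L * d"
    using degree_power_le[of b L] db by (metis mult.commute mult_le_mono2 order_trans)
  thus "degree p \<le> card I + L * d"
    unfolding p_def using dz degree_mult_le[of z "b ^ L"] by linarith
  have pb: "poly b x = poly (fejer d) (x / t) / (real d)\<^sup>2" for x
    by (simp add: b_def poly_pcompose)
  have pz: "poly z x = (\<Prod>u\<in>I. 1 - x / l u)" for x
    by (simp add: z_def poly_prod)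
  show "poly p 0 = 1" using d0 by (simp add: p_def pb pz poly_fejer_0)
  show "poly p (l u) = 0" if "u \<in> I" for u
  proof -
    have "l u > 0" using l[OF that] t by simp
    hence "poly z (l u) = 0" unfolding pz using fin that by (intro prod_zero) (auto intro!: bexI[of _ u])
    thus ?thesis by (simp add: p_def)
  qed
  have b01: "0 \<le> poly b x" "poly b x \<le> 1" "x * poly b x \<le> t / (real d)\<^sup>2" if "0 \<le> x" "x < t" for x
  proof -
    have x: "0 \<le> x / t" "x / t \<le> 1" using that t by auto
    show "0 \<le> poly b x" "poly b x \<le> 1"
      unfolding pb using fejer_bounds(1,2)[OF x, of d] d0 by (auto simp: divide_le_eq_1)
    have "x * poly b x = t * (x / t * poly (fejer d) (x / t)) / (real d)\<^sup>2" unfolding pb using t by simp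
    also have "\<dots> \<le> t * 1 / (real d)\<^sup>2"
      using fejer_bounds(3)[OF x, of d] t d0 by (intro divide_right_mono mult_left_mono) auto
    finally show "x * poly b x \<le> t / (real d)\<^sup>2" by simp
  qed
  have z1: "\<bar>poly z x\<bar> \<le> 1" if "0 \<le> x" "x < t" for x
  proof -
    have "\<bar>1 - x / l u\<bar> \<le> 1" if "u \<in> I" for u
      using l[OF that] t \<open>0 \<le> x\<close> \<open>x < t\<close> by (auto simp: abs_le_iff field_simps)
    thus ?thesis unfolding pz abs_prod by (intro prod_le_1) auto
  qed
  have pp: "\<bar>poly p x\<bar> \<le> poly b x ^ L" if "0 \<le> x" "x < t" for x
    using z1[OF that] b01(1)[OF that]
    by (simp add: p_def abs_mult poly_power mult_left_le_one_le)
  show "\<bar>poly p x\<bar> \<le> 1" if "0 \<le> x" "x < t" for x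
    using pp[OF that] b01[OF that] power_le_one[of "poly b x" L] by linarith
  show "x powr a * \<bar>poly p x\<bar> \<le> (t / (real d)\<^sup>2) powr a"
    if "0 \<le> x" "x < t" "1 \<le> a" "a \<le> real L" for x a
  proof -
    have "poly b x ^ L \<le> poly b x powr a"
    proof (cases "poly b x = 0")
      case True
      thus ?thesis using L by (simp add: power_0_left)
    next
      case False
      hence "poly b x > 0" using b01(1)[OF that(1,2)] by simp
      thus ?thesis using b01(2)[OF that(1,2)] that(4)
        by (simp add: powr_realpow[symmetric] powr_mono')
    qed
    hence "x powr a * \<bar>poly p x\<bar> \<le> x powr a * poly b x powr a"
      using pp[OF that(1,2)] by (intro mult_left_mono) auto
    also have "\<dots> = (x * poly b x) powr a" using that b01(1)[OF that(1,2)] by (simp add: powr_mult)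
    also have "\<dots> \<le> (t / (real d)\<^sup>2) powr a"
      using b01[OF that(1,2)] that by (intro powr_mono2) auto
    finally show ?thesis .
  qed
qed

section \<open>Orthonormal sets and the spectral theorem in finite dimension\<close>

definition orthonormal :: "'a::real_inner set \<Rightarrow> bool" where
  "orthonormal B \<longleftrightarrow> (\<forall>u\<in>B. \<forall>w\<in>B. u \<bullet> w = (if u = w then 1 else 0))"

lemma orthonormal_expand:
  assumes "finite B" "orthonormal B" "z \<in> span B"
  shows "z = (\<Sum>u\<in>B. (u \<bullet> z) *\<^sub>R u)"
proof -
  obtain c where c: "z = (\<Sum>u\<in>B. c u *\<^sub>R u)" using assms(1,3) by (auto simp: span_finite)
  have "u \<bullet> z = c u" if "u \<in> B" for u
  proof -
    have "u \<bullet> z = (\<Sum>w\<in>B. c w * (if w = u then 1 else 0))"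
      unfolding c inner_sum_right inner_scaleR_right
      using assms(2) that by (intro sum.cong) (auto simp: orthonormal_def)
    thus ?thesis using assms(1) that by (simp add: if_distrib cong: if_cong)
  qed
  thus ?thesis using c by (metis (no_types, lifting) sum.cong)
qed

lemma norm_sum_orthonormal:
  assumes "finite F" "\<And>i j. i \<in> F \<Longrightarrow> j \<in> F \<Longrightarrow> e i \<bullet> e j = (if i = j then 1 else (0::real))"
  shows "(norm (\<Sum>i\<in>F. c i *\<^sub>R e i))\<^sup>2 = (\<Sum>i\<in>F. (c i)\<^sup>2)"
proof -
  have "(norm (\<Sum>i\<in>F. c i *\<^sub>R e i))\<^sup>2 = (\<Sum>i\<in>F. \<Sum>j\<in>F. c i * (c j * (e i \<bullet> e j)))"
    unfolding power2_norm_eq_inner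
    by (simp add: inner_sum_left inner_sum_right sum_distrib_left inner_commute mult_ac)
  also have "\<dots> = (\<Sum>i\<in>F. \<Sum>j\<in>F. if i = j then (c i)\<^sup>2 else 0)"
    using assms(2) by (intro sum.cong) (auto simp: power2_eq_square)
  also have "\<dots> = (\<Sum>i\<in>F. (c i)\<^sup>2)" using assms(1) by simp
  finally show ?thesis .
qed

lemma bessel:
  fixes e :: "'i \<Rightarrow> 'a::real_inner"
  assumes "finite F" "\<And>i j. i \<in> F \<Longrightarrow> j \<in> F \<Longrightarrow> e i \<bullet> e j = (if i = j then 1 else (0::real))"
  shows "(\<Sum>i\<in>F. (e i \<bullet> z)\<^sup>2) \<le> (norm z)\<^sup>2"
proof -
  define y where "y = (\<Sum>i\<in>F. (e i \<bullet> z) *\<^sub>R e i)"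
  have ny: "(norm y)\<^sup>2 = (\<Sum>i\<in>F. (e i \<bullet> z)\<^sup>2)"
    unfolding y_def by (rule norm_sum_orthonormal) (use assms in auto)
  have "y \<bullet> z = (\<Sum>i\<in>F. (e i \<bullet> z)\<^sup>2)"
    unfolding y_def by (simp add: inner_sum_left power2_eq_square)
  hence "(norm y)\<^sup>2 \<le> norm y * norm z"
    using ny norm_cauchy_schwarz[of y z] by simp
  hence "norm y \<le> norm z"
    by (metis mult_le_cancel_left_pos norm_ge_zero order_le_less power2_eq_square)
  thus ?thesis using ny by (metis norm_ge_zero power_mono)
qed

lemma orthonormal_D: "orthonormal B \<Longrightarrow> i \<in> B \<Longrightarrow> j \<in> B \<Longrightarrow> i \<bullet> j = (if i = j then 1 else 0)"
  by (auto simp: orthonormal_def)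

lemma parseval_finite:
  assumes "finite B" "orthonormal B" "z \<in> span B"
  shows "(norm z)\<^sup>2 = (\<Sum>u\<in>B. (u \<bullet> z)\<^sup>2)"
  using norm_sum_orthonormal[OF assms(1) orthonormal_D[OF assms(2)], of "\<lambda>u. u \<bullet> z"]
    orthonormal_expand[OF assms] by simp

text \<open>
  Compactness of the unit sphere of a finite-dimensional subspace is reduced to this box, which is built up one
  coordinate at a time as a continuous image of a product of compact sets; the ambient space may be
  infinite-dimensional.
\<close>

lemma compact_coefficient_box:
  fixes E :: "'a::real_normed_vector set"
  assumes "finite E"
  shows "compact {\<Sum>e\<in>E. c e *\<^sub>R e | c. \<forall>e\<in>E. \<bar>c e\<bar> \<le> 1}"
  using assms
proof (induction E)
  case (insert a E)
  let ?B = "\<lambda>E. {\<Sum>e\<in>E. c e *\<^sub>R e | c. \<forall>e\<in>E. \<bar>c e\<bar> \<le> (1::real)}"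
  have "?B (insert a E) = (\<lambda>(r, y). r *\<^sub>R a + y) ` ({-1..1} \<times> ?B E)" (is "?L = ?R")
  proof
    show "?L \<subseteq> ?R"
    proof
      fix z assume "z \<in> ?L"
      then obtain c where c: "z = (\<Sum>e\<in>insert a E. c e *\<^sub>R e)" "\<forall>e\<in>insert a E. \<bar>c e\<bar> \<le> 1" by auto
      have "z = (\<lambda>(r, y). r *\<^sub>R a + y) (c a, \<Sum>e\<in>E. c e *\<^sub>R e)"
        using c insert by simp
      moreover have "(c a, \<Sum>e\<in>E. c e *\<^sub>R e) \<in> {-1..1} \<times> ?B E" using c by (auto simp: abs_le_iff)
      ultimately show "z \<in> ?R" by blast
    qed
    show "?R \<subseteq> ?L"
    proof
      fix z assume "z \<in> ?R"
      then obtain r c where c: "z = r *\<^sub>R a + (\<Sum>e\<in>E. c e *\<^sub>R e)" "\<bar>r\<bar> \<le> 1" "\<forall>e\<in>E. \<bar>c e\<bar> \<le> 1"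
        by (auto simp: abs_le_iff)
      have "(\<Sum>e\<in>E. c e *\<^sub>R e) = (\<Sum>e\<in>E. (c(a := r)) e *\<^sub>R e)"
        using insert by (intro sum.cong) auto
      hence "z = (\<Sum>e\<in>insert a E. (c(a := r)) e *\<^sub>R e)" using insert c by simp
      moreover have "\<forall>e\<in>insert a E. \<bar>(c(a := r)) e\<bar> \<le> 1" using c by simp
      ultimately show "z \<in> ?L" by blast
    qed
  qed
  moreover have "compact ?R"
    by (intro compact_continuous_image compact_Times insert.IH)
      (auto intro!: continuous_intros simp: case_prod_beta)
  ultimately show ?case by simp
qed simp

lemma orthonormal_basis_exists:
  fixes S :: "'a::real_inner set"
  assumes "finite S"
  obtains E where "finite E" "orthonormal E" "span E = span S"
proof -
  obtain C where C: "finite C" "span C = span S" "pairwise orthogonal C"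
    using basis_orthogonal[OF assms] by auto
  define E where "E = (\<lambda>c. c /\<^sub>R norm c) ` (C - {0})"
  have "span E = span (C - {0})"
    unfolding E_def using C(1) by (intro span_image_scale) auto
  hence "span E = span S" using C(2) by (simp add: span_delete_0)
  moreover have "orthonormal E"
    unfolding orthonormal_def E_def
  proof (intro ballI)
    fix u w assume "u \<in> (\<lambda>c. c /\<^sub>R norm c) ` (C - {0})" "w \<in> (\<lambda>c. c /\<^sub>R norm c) ` (C - {0})"
    then obtain a b where ab: "a \<in> C" "a \<noteq> 0" "u = a /\<^sub>R norm a" "b \<in> C" "b \<noteq> 0" "w = b /\<^sub>R norm b" by auto
    show "u \<bullet> w = (if u = w then 1 else 0)"
    proof (cases "a = b")
      case True
      thus ?thesis using ab by (simp add: dot_square_norm power2_eq_square)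
    next
      case False
      hence "a \<bullet> b = 0" using C(3) ab by (auto simp: pairwise_def orthogonal_def)
      hence "u \<bullet> w = 0" using ab by simp
      moreover have "u \<bullet> u \<noteq> 0" using ab by simp
      ultimately show ?thesis by auto
    qed
  qed
  ultimately show ?thesis using that[of E] C(1) by (auto simp: E_def)
qed

lemma compact_sphere_span:
  fixes S :: "'a::real_inner set"
  assumes "finite S"
  shows "compact {z \<in> span S. norm z = 1}"
proof -
  obtain E where E: "finite E" "orthonormal E" "span E = span S"
    using orthonormal_basis_exists[OF assms] .
  have eq: "{z \<in> span S. norm z = 1} = {\<Sum>e\<in>E. c e *\<^sub>R e | c. \<forall>e\<in>E. \<bar>c e\<bar> \<le> 1} \<inter> {z. norm z = 1}"
  proof (intro equalityI subsetI)
    fix z assume z: "z \<in> {z \<in> span S. norm z = 1}"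
    have "norm e = 1" if "e \<in> E" for e
      using E(2) that by (auto simp: orthonormal_def norm_eq_1)
    hence "\<bar>e \<bullet> z\<bar> \<le> 1" if "e \<in> E" for e
      using Cauchy_Schwarz_ineq2[of e z] that z by simp
    moreover have "z = (\<Sum>e\<in>E. (e \<bullet> z) *\<^sub>R e)"
      using orthonormal_expand[OF E(1,2)] z E(3) by simp
    ultimately show "z \<in> {\<Sum>e\<in>E. c e *\<^sub>R e | c. \<forall>e\<in>E. \<bar>c e\<bar> \<le> 1} \<inter> {z. norm z = 1}"
      using z by (intro IntI CollectI exI[of _ "\<lambda>e. e \<bullet> z"]) auto
  qed (auto simp: E(3)[symmetric] intro!: span_sum span_scale intro: span_base)
  have cl: "closed {z::'a. norm z = 1}" by (intro closed_Collect_eq continuous_intros)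
  show ?thesis unfolding eq by (rule compact_Int_closed[OF compact_coefficient_box[OF E(1)] cl])
qed

text \<open>
  A maximiser \<open>u\<close> of the Rayleigh quotient on the unit sphere is an eigenvector.  With \<open>l\<close> the maximum, the form
  \<open>z \<mapsto> l \<parallel>z\<parallel>\<^sup>2 - T z \<bullet> z\<close> is nonnegative on \<open>V\<close> and vanishes at \<open>u\<close>; moving from \<open>u\<close> a distance \<open>r\<close> in the direction
  \<open>d = T u - l u\<close> changes it to first order by \<open>- 2 r \<parallel>d\<parallel>\<^sup>2\<close>, which forces \<open>d = 0\<close>.  The subspace is given through
  compactness of its sphere, so that the lemma applies to orthogonal complements directly.
\<close>

lemma symmetric_has_eigenvector:
  fixes T :: "'a::real_inner \<Rightarrow> 'a"
  assumes T: "bounded_linear T" and sym: "\<And>a b. T a \<bullet> b = a \<bullet> T b"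
    and V: "subspace V" "compact {z \<in> V. norm z = 1}" and inv: "\<And>z. z \<in> V \<Longrightarrow> T z \<in> V"
    and w: "w \<in> V" "w \<noteq> 0"
  obtains u l where "u \<in> V" "norm u = 1" "T u = l *\<^sub>R u"
proof -
  interpret T: bounded_linear T by (rule T)
  have unit: "z /\<^sub>R norm z \<in> {z \<in> V. norm z = 1}" if "z \<in> V" "z \<noteq> 0" for z
    using that V(1) by (simp add: subspace_scale)
  have "\<exists>u\<in>{z \<in> V. norm z = 1}. \<forall>z\<in>{z \<in> V. norm z = 1}. T z \<bullet> z \<le> T u \<bullet> u"
    by (rule continuous_attains_sup[OF V(2)])
      (use unit[OF w] in \<open>auto intro!: continuous_intros T.continuous_on\<close>)
  then obtain u where u: "u \<in> V" "norm u = 1" and max: "\<And>z. z \<in> V \<Longrightarrow> norm z = 1 \<Longrightarrow> T z \<bullet> z \<le> T u \<bullet> u"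
    by auto
  define l where "l = T u \<bullet> u"
  have Q: "T z \<bullet> z \<le> l * (z \<bullet> z)" if "z \<in> V" for z
  proof (cases "z = 0")
    case False
    have "T (z /\<^sub>R norm z) \<bullet> (z /\<^sub>R norm z) \<le> l"
      unfolding l_def using unit[OF that False] by (intro max) auto
    hence "(T z \<bullet> z) / (norm z)\<^sup>2 \<le> l"
      by (simp add: T.scaleR power2_eq_square divide_inverse mult_ac)
    thus ?thesis using False by (simp add: divide_le_eq dot_square_norm)
  qed (simp add: T.zero)
  define d where "d = T u - l *\<^sub>R u"
  have d: "d \<in> V" unfolding d_def using u inv V(1) by (intro subspace_diff subspace_scale) auto
  have ud: "T u \<bullet> d - l * (u \<bullet> d) = d \<bullet> d"
    by (simp add: d_def inner_diff_left)
  have uu: "u \<bullet> u = 1" using u(2) by (simp add: norm_eq_1)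
  have key: "2 * r * (d \<bullet> d) \<le> r\<^sup>2 * (l * (d \<bullet> d) - T d \<bullet> d)" for r
  proof -
    have "u + r *\<^sub>R d \<in> V" using u d V(1) by (intro subspace_add subspace_scale) auto
    from Q[OF this] have "T u \<bullet> u + r * (T u \<bullet> d) + r * (T d \<bullet> u) + r\<^sup>2 * (T d \<bullet> d)
        \<le> l * (u \<bullet> u + 2 * r * (u \<bullet> d) + r\<^sup>2 * (d \<bullet> d))"
      by (simp add: T.add T.scaleR inner_add_left inner_add_right power2_eq_square
          inner_commute[of d u] algebra_simps)
    moreover have "T d \<bullet> u = T u \<bullet> d" using sym[of d u] by (simp add: inner_commute)
    ultimately have "2 * (r * (T u \<bullet> d)) + r\<^sup>2 * (T d \<bullet> d) \<le> 2 * (r * (l * (u \<bullet> d))) + r\<^sup>2 * (l * (d \<bullet> d))"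
      unfolding uu l_def[symmetric] by (simp add: algebra_simps)
    hence "2 * (r * (T u \<bullet> d - l * (u \<bullet> d))) \<le> r\<^sup>2 * (l * (d \<bullet> d) - T d \<bullet> d)"
      unfolding right_diff_distrib by linarith
    thus ?thesis unfolding ud by (simp add: mult.assoc)
  qed
  have "d \<bullet> d = 0"
  proof (rule ccontr)
    assume "d \<bullet> d \<noteq> 0"
    hence dd: "d \<bullet> d > 0" by (metis inner_ge_zero order_le_less)
    define c where "c = l * (d \<bullet> d) - T d \<bullet> d"
    have c0: "c \<ge> 0" unfolding c_def using Q[OF d] by simp
    \<comment> \<open>any step below \<open>2 \<parallel>d\<parallel>\<^sup>2 / c\<close> contradicts \<open>key\<close>; the \<open>+ 1\<close> covers \<open>c = 0\<close>\<close>
    define r where "r = (d \<bullet> d) / (c + 1)"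
    have r0: "r > 0" unfolding r_def using dd c0 by simp
    have "2 * r * (d \<bullet> d) \<le> r * (r * c)" using key[of r] by (simp add: c_def power2_eq_square)
    hence "2 * (d \<bullet> d) \<le> r * c" using r0 by (simp add: mult.assoc mult.left_commute)
    also have "\<dots> \<le> d \<bullet> d" unfolding r_def using dd c0 by (simp add: field_simps)
    finally show False using dd by simp
  qed
  hence "T u = l *\<^sub>R u" by (simp add: d_def)
  thus ?thesis using that u by blast
qed

lemma orthonormal_independent:
  assumes "orthonormal B"
  shows "independent B"
proof (rule pairwise_orthogonal_independent)
  show "pairwise orthogonal B" using assms by (auto simp: pairwise_def orthogonal_def orthonormal_def)
  show "0 \<notin> B" using assms by (auto simp: orthonormal_def dest!: bspec[of _ _ "0::'a"])
qed

text \<open>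
  An orthonormal set of eigenvectors of maximal cardinality spans: otherwise the part of \<open>span S\<close> orthogonal to it is
  a nonzero invariant subspace and contributes one more eigenvector.
\<close>

lemma spectral_theorem_finite:
  fixes T :: "'a::real_inner \<Rightarrow> 'a"
  assumes T: "bounded_linear T" and sym: "\<And>a b. T a \<bullet> b = a \<bullet> T b"
    and S: "finite S" and inv: "\<And>z. z \<in> span S \<Longrightarrow> T z \<in> span S"
  obtains B l where "finite B" "orthonormal B" "span B = span S" "\<And>u. u \<in> B \<Longrightarrow> T u = l u *\<^sub>R u"
proof -
  define good where "good B \<longleftrightarrow> finite B \<and> orthonormal B \<and> B \<subseteq> span S \<and> (\<forall>u\<in>B. \<exists>l. T u = l *\<^sub>R u)" for B
  have bound: "card B \<le> card S" if "good B" for B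
    using independent_span_bound[OF S orthonormal_independent] that by (auto simp: good_def)
  have "good {}" by (simp add: good_def orthonormal_def)
  then obtain B where B: "good B" and max: "\<And>B'. good B' \<Longrightarrow> card B' \<le> card B"
    using ex_has_greatest_nat[of good "{}" card "card S + 1"] bound by (metis less_Suc_eq_le Suc_eq_plus1)
  have B': "finite B" "orthonormal B" "B \<subseteq> span S" "\<And>u. u \<in> B \<Longrightarrow> \<exists>l. T u = l *\<^sub>R u"
    using B by (auto simp: good_def)
  have "span B = span S"
  proof (rule ccontr)
    assume "span B \<noteq> span S"
    moreover have "span B \<subseteq> span S" using B'(3) by (metis span_mono span_span)
    ultimately obtain w where w: "w \<in> span S" "w \<notin> span B" by blast
    define V where "V = {z \<in> span S. \<forall>u\<in>B. u \<bullet> z = 0}"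
    define w' where "w' = w - (\<Sum>u\<in>B. (u \<bullet> w) *\<^sub>R u)"
    have pr: "(\<Sum>u\<in>B. (u \<bullet> w) *\<^sub>R u) \<in> span B" by (intro span_sum span_scale span_base)
    have "w' \<noteq> 0" using pr w(2) by (auto simp: w'_def)
    have "u \<bullet> w' = 0" if "u \<in> B" for u
    proof -
      have "u \<bullet> (\<Sum>u\<in>B. (u \<bullet> w) *\<^sub>R u) = (\<Sum>x\<in>B. (x \<bullet> w) * (if x = u then 1 else 0))"
        unfolding inner_sum_right inner_scaleR_right using B'(2) that
        by (intro sum.cong) (auto simp: orthonormal_def)
      also have "\<dots> = u \<bullet> w" using that B'(1) by (simp add: if_distrib cong: if_cong)
      finally show ?thesis by (simp add: w'_def inner_diff_right)
    qed
    moreover have "w' \<in> span S" unfolding w'_def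
      using w pr \<open>span B \<subseteq> span S\<close> by (intro span_diff) auto
    ultimately have "w' \<in> V" by (simp add: V_def)
    have sub: "subspace V" unfolding V_def
      by (auto simp: subspace_def inner_add_right span_zero span_add span_scale)
    have eq: "{z \<in> V. norm z = 1} = {z \<in> span S. norm z = 1} \<inter> (\<Inter>u\<in>B. {z. u \<bullet> z = 0})"
      by (auto simp: V_def)
    have cl: "closed (\<Inter>u\<in>B. {z. u \<bullet> z = 0})"
      by (intro closed_INT ballI closed_Collect_eq continuous_intros)
    have cpt: "compact {z \<in> V. norm z = 1}"
      unfolding eq by (rule compact_Int_closed[OF compact_sphere_span[OF S] cl])
    have invV: "T z \<in> V" if "z \<in> V" for z
    proof -
      have "u \<bullet> T z = 0" if uB: "u \<in> B" for u
      proof -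
        obtain l where "T u = l *\<^sub>R u" using B'(4)[OF uB] by blast
        hence "u \<bullet> T z = l * (u \<bullet> z)" using sym[of u z] by simp
        thus ?thesis using that \<open>z \<in> V\<close> by (simp add: V_def)
      qed
      thus ?thesis using that inv by (auto simp: V_def)
    qed
    obtain u l where u: "u \<in> V" "norm u = 1" "T u = l *\<^sub>R u"
      by (rule symmetric_has_eigenvector[OF T sym sub cpt invV \<open>w' \<in> V\<close> \<open>w' \<noteq> 0\<close>])
    have "u \<notin> B" using u by (auto simp: V_def)
    have "good (insert u B)"
      using B' u unfolding good_def orthonormal_def V_def
      by (auto simp: inner_commute norm_eq_1)
    from max[OF this] show False using B'(1) \<open>u \<notin> B\<close> by simp
  qed
  moreover obtain l where "\<And>u. u \<in> B \<Longrightarrow> T u = l u *\<^sub>R u" using B'(4) by metis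
  ultimately show ?thesis using that B' by blast
qed

section \<open>Krylov spaces and minimal residuals\<close>

definition op_poly :: "real poly \<Rightarrow> ('a::real_vector \<Rightarrow> 'a) \<Rightarrow> 'a \<Rightarrow> 'a" where
  "op_poly p T b = (\<Sum>i\<le>degree p. coeff p i *\<^sub>R (T ^^ i) b)"

lemma inner_op_poly_eigenvector:
  assumes sym: "\<And>a b. T a \<bullet> b = a \<bullet> T b" and u: "T u = l *\<^sub>R u"
  shows "u \<bullet> op_poly p T b = poly p l * (u \<bullet> b)"
proof -
  have pow: "u \<bullet> (T ^^ i) b = l ^ i * (u \<bullet> b)" for i
  proof (induction i)
    case (Suc i)
    have "u \<bullet> (T ^^ Suc i) b = T u \<bullet> (T ^^ i) b" by (simp add: sym)
    thus ?case using Suc u by simp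
  qed simp
  show ?thesis
    by (simp add: op_poly_def inner_sum_right pow poly_altdef sum_distrib_right sum_distrib_left mult_ac)
qed

lemma op_poly_in_invariant_subspace:
  assumes "subspace V" "\<And>z. z \<in> V \<Longrightarrow> T z \<in> V" "b \<in> V"
  shows "op_poly p T b \<in> V"
proof -
  have "(T ^^ i) b \<in> V" for i by (induction i) (use assms in auto)
  thus ?thesis unfolding op_poly_def using assms(1) by (intro subspace_sum subspace_scale)
qed

lemma best_approximation_exists:
  fixes S :: "'a::real_inner set"
  assumes "finite S"
  obtains z where "z \<in> span S" "\<And>y. y \<in> span S \<Longrightarrow> norm (r - z) \<le> norm (r - y)"
proof -
  obtain E where E: "finite E" "orthonormal E" "span E = span S"
    using orthonormal_basis_exists[OF assms] .
  define z where "z = (\<Sum>e\<in>E. (e \<bullet> r) *\<^sub>R e)"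
  have z: "z \<in> span S" unfolding z_def E(3)[symmetric] by (intro span_sum span_scale span_base)
  have ez: "e \<bullet> z = e \<bullet> r" if "e \<in> E" for e
  proof -
    have "e \<bullet> z = (\<Sum>x\<in>E. (x \<bullet> r) * (if x = e then 1 else 0))"
      unfolding z_def inner_sum_right inner_scaleR_right
      using E(2) that by (intro sum.cong) (auto simp: orthonormal_def)
    thus ?thesis using that E(1) by (simp add: if_distrib cong: if_cong)
  qed
  have orth: "(r - z) \<bullet> d = 0" if "d \<in> span S" for d
  proof -
    have "(r - z) \<bullet> d = (\<Sum>e\<in>E. (e \<bullet> d) * ((r - z) \<bullet> e))"
      using arg_cong[OF orthonormal_expand[OF E(1,2)], of d "inner (r - z)"] that E(3)
      by (simp add: inner_sum_right)
    moreover have "(r - z) \<bullet> e = 0" if "e \<in> E" for e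
      using ez[OF that] by (simp add: inner_diff_left inner_diff_right inner_commute)
    ultimately show ?thesis by simp
  qed
  have "norm (r - z) \<le> norm (r - y)" if "y \<in> span S" for y
  proof -
    have "(r - z) \<bullet> (z - y) = 0" using z that by (intro orth span_diff)
    hence "(norm (r - z + (z - y)))\<^sup>2 = (norm (r - z))\<^sup>2 + (norm (z - y))\<^sup>2"
      using norm_add_Pythagorean[of "r - z" "z - y"] by (simp add: orthogonal_def)
    hence "(norm (r - z))\<^sup>2 \<le> (norm (r - y))\<^sup>2" by simp
    thus ?thesis by (rule power2_le_imp_le) simp
  qed
  with z that show ?thesis by blast
qed

lemma bounded_linear_emp_K: "bounded_linear (emp_K n x)"
  unfolding emp_K_def rank_one_def
  by (intro bounded_linear_intros bounded_linear_const_scaleR bounded_linear_sum bounded_linear_scaleR_const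
      bounded_linear_inner_right)

lemma emp_K_symmetric: "emp_K n x a \<bullet> b = a \<bullet> emp_K n x b"
  by (simp add: emp_K_def rank_one_def inner_sum_left inner_sum_right inner_commute mult_ac)

lemma emp_K_nonneg: "0 \<le> a \<bullet> emp_K n x a"
  by (auto simp: emp_K_def rank_one_def inner_sum_right inner_commute intro!: divide_nonneg_nonneg sum_nonneg)

lemma emp_K_in_span: "emp_K n x a \<in> span (x ` {1..n})"
  unfolding emp_K_def rank_one_def by (intro span_scale span_sum span_base) auto

lemma emp_r_in_span: "emp_r n x y \<in> span (x ` {1..n})"
  unfolding emp_r_def by (intro span_scale span_sum span_base) auto

lemma krylov_eq: "krylov n x y m = span ((\<lambda>k. (emp_K n x ^^ k) (emp_r n x y)) ` {..<m})"
  unfolding krylov_def by (rule arg_cong[of _ _ span]) auto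

lemma pls_minimizes_residual:
  shows pls_in_krylov: "pls n x y m \<in> krylov n x y m"
    and residual_pls_le: "b \<in> krylov n x y m \<Longrightarrow>
      norm (emp_r n x y - emp_K n x (pls n x y m)) \<le> norm (emp_r n x y - emp_K n x b)"
proof -
  let ?r = "emp_r n x y" and ?T = "emp_K n x" and ?V = "krylov n x y m"
  have "pls n x y m \<in> ?V \<and> (\<forall>b\<in>?V. norm (?r - ?T (pls n x y m)) \<le> norm (?r - ?T b))"
  proof (cases "m = 0")
    case True
    thus ?thesis by (simp add: krylov_eq pls_def)
  next
    case False
    let ?G = "(\<lambda>k. (?T ^^ k) ?r) ` {..<m}"
    obtain z where z: "z \<in> span (?T ` ?G)" "\<And>w. w \<in> span (?T ` ?G) \<Longrightarrow> norm (?r - z) \<le> norm (?r - w)"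
      using best_approximation_exists[of "?T ` ?G" ?r] by auto
    have im: "span (?T ` ?G) = ?T ` ?V"
      unfolding krylov_eq by (rule linear_span_image[OF bounded_linear.linear[OF bounded_linear_emp_K]])
    then obtain b0 where b0: "b0 \<in> ?V" "z = ?T b0" using z(1) by auto
    have min: "(norm (?r - ?T b0))\<^sup>2 \<le> (norm (?r - ?T w))\<^sup>2" if "w \<in> ?V" for w
      using z(2)[of "?T w"] that b0 im by (auto intro!: power_mono)
    show ?thesis
      unfolding pls_def if_not_P[OF False]
    proof (rule arg_minI[where P = "\<lambda>b. b \<in> ?V" and x = b0])
      fix b assume "b \<in> ?V" "\<forall>w. w \<in> ?V \<longrightarrow> \<not> (norm (?r - ?T w))\<^sup>2 < (norm (?r - ?T b))\<^sup>2"
      thus "b \<in> ?V \<and> (\<forall>w\<in>?V. norm (?r - ?T b) \<le> norm (?r - ?T w))"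
        by (meson norm_ge_zero not_le_imp_less power2_le_imp_le)
    qed (use b0 min in \<open>auto simp: not_less\<close>)
  qed
  thus "pls n x y m \<in> ?V" "b \<in> ?V \<Longrightarrow> norm (?r - ?T (pls n x y m)) \<le> norm (?r - ?T b)" by auto
qed

text \<open>
  If \<open>p(0) = 1\<close>, then \<open>p(x) = 1 - x g(x)\<close> with \<open>g\<close> of smaller degree, and \<open>b = g(T) r\<close> is a competitor in the Krylov
  space whose residual is \<open>r - T b = p(T) r\<close>.
\<close>

lemma pls_residual_le_op_poly:
  assumes "degree p \<le> m" "poly p 0 = 1"
  shows "norm (emp_r n x y - emp_K n x (pls n x y m)) \<le> norm (op_poly p (emp_K n x) (emp_r n x y))"
proof -
  let ?r = "emp_r n x y" and ?T = "emp_K n x"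
  interpret T: bounded_linear ?T by (rule bounded_linear_emp_K)
  \<comment> \<open>this is \<open>g(T) r\<close> for \<open>p(x) = 1 - x g(x)\<close>\<close>
  define b where "b = - (\<Sum>k<m. coeff p (Suc k) *\<^sub>R (?T ^^ k) ?r)"
  have "b \<in> krylov n x y m"
    unfolding b_def krylov_eq by (intro span_neg span_sum span_scale span_base) auto
  moreover have "?r - ?T b = op_poly p ?T ?r"
  proof -
    have "op_poly p ?T ?r = (\<Sum>i\<le>m. coeff p i *\<^sub>R (?T ^^ i) ?r)"
      unfolding op_poly_def using assms(1)
      by (intro sum.mono_neutral_left) (auto simp: coeff_eq_0)
    also have "\<dots> = coeff p 0 *\<^sub>R ?r + (\<Sum>k<m. coeff p (Suc k) *\<^sub>R (?T ^^ Suc k) ?r)"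
      unfolding lessThan_Suc_atMost[symmetric] by (subst sum.lessThan_Suc_shift) simp
    also have "\<dots> = ?r - ?T b"
      using assms(2) by (simp add: b_def T.neg T.sum T.scaleR poly_0_coeff_0)
    finally show ?thesis by simp
  qed
  ultimately show ?thesis using residual_pls_le[of b n x y m] by simp
qed

text \<open>
  Here \<open>\<mu> \<ge> 1\<close> is essential: for \<open>\<mu> < 1\<close> the derivative of \<open>x\<^sup>\<mu>\<close> is unbounded near \<open>0\<close>.
\<close>

lemma powr_diff_le:
  fixes a b :: real
  assumes "1 \<le> \<mu>" "0 \<le> a" "a \<le> \<Lambda>" "0 \<le> b" "b \<le> \<Lambda>"
  shows "\<bar>a powr \<mu> - b powr \<mu>\<bar> \<le> \<mu> * \<Lambda> powr (\<mu> - 1) * \<bar>a - b\<bar>"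
proof -
  have main: "\<bar>b powr \<mu> - a powr \<mu>\<bar> \<le> \<mu> * \<Lambda> powr (\<mu> - 1) * \<bar>b - a\<bar>"
    if "0 \<le> a" "a < b" "b \<le> \<Lambda>" for a b
  proof (cases "a = 0")
    case True
    have "b powr \<mu> = b powr (\<mu> - 1) * b"
      using that True powr_mult_base[of b "\<mu> - 1"] by (simp add: mult.commute)
    also have "\<dots> \<le> \<Lambda> powr (\<mu> - 1) * b"
      using that assms(1) True by (intro mult_right_mono powr_mono2) auto
    also have "\<dots> \<le> \<mu> * (\<Lambda> powr (\<mu> - 1) * b)"
      using that assms(1) True mult_right_mono[of 1 \<mu> "\<Lambda> powr (\<mu> - 1) * b"] by simp
    finally show ?thesis using True that by (simp add: mult.assoc)
  next
    case False
    have "\<exists>z. a < z \<and> z < b \<and> b powr \<mu> - a powr \<mu> = (b - a) * (\<mu> * z powr (\<mu> - 1))"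
      by (rule MVT2) (use that False in \<open>auto intro!: derivative_eq_intros\<close>)
    then obtain z where z: "a < z" "z < b" "b powr \<mu> - a powr \<mu> = (b - a) * (\<mu> * z powr (\<mu> - 1))"
      by auto
    have "z powr (\<mu> - 1) \<le> \<Lambda> powr (\<mu> - 1)" using z that assms(1) by (intro powr_mono2) auto
    thus ?thesis unfolding z(3) using that z assms(1)
      by (simp add: abs_mult mult_ac mult_left_mono)
  qed
  consider "a < b" | "b < a" | "a = b" by linarith
  thus ?thesis
    using main[of a b] main[of b a] assms by cases (auto simp: abs_minus_commute)
qed

section \<open>Comparison of the empirical with the population spectrum\<close>

text \<open>
  A complete orthonormal system with positive weights, as provided by a compact positive operator with trivial kernel.
  Completeness is expressed by partial sums in the order of the index, so that all estimates can be made for finite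
  index sets and then passed to the limit.
\<close>

locale eigenbasis =
  fixes J :: "nat set" and lam :: "nat \<Rightarrow> real" and v :: "nat \<Rightarrow> 'a::real_inner"
  assumes J_pos: "J \<subseteq> {1..}"
    and orth: "\<And>i j. i \<in> J \<Longrightarrow> j \<in> J \<Longrightarrow> v i \<bullet> v j = (if i = j then 1 else 0)"
    and lam_pos: "\<And>j. j \<in> J \<Longrightarrow> 0 < lam j"
    and expand: "\<And>b. (\<lambda>N. \<Sum>j\<in>J \<inter> {..N}. (v j \<bullet> b) *\<^sub>R v j) \<longlonglongrightarrow> b"

text \<open>
  Two diagonalised operators at Hilbert--Schmidt distance at most \<open>h\<close>: the operator \<open>T\<close> through its finite eigenbasis
  \<open>B\<close>, and the one with eigenpairs \<open>(lam j, v j)\<close>.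
\<close>

locale perturbed_eigenbasis = eigenbasis +
  fixes T :: "'a::real_inner \<Rightarrow> 'a" and B :: "'a set" and l :: "'a \<Rightarrow> real" and h :: real
  assumes sym: "\<And>a b. T a \<bullet> b = a \<bullet> T b"
    and finB: "finite B" and onB: "orthonormal B"
    and eigen: "\<And>u. u \<in> B \<Longrightarrow> T u = l u *\<^sub>R u"
    and l_nonneg: "\<And>u. u \<in> B \<Longrightarrow> 0 \<le> l u"
    and h_nonneg: "0 \<le> h"
    and hs: "\<And>F. finite F \<Longrightarrow> F \<subseteq> J \<Longrightarrow> (\<Sum>j\<in>F. (norm (T (v j) - lam j *\<^sub>R v j))\<^sup>2) \<le> h\<^sup>2"
begin

lemma bessel_B: "(\<Sum>u\<in>B. (u \<bullet> z)\<^sup>2) \<le> (norm z)\<^sup>2"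
  using bessel[OF finB, of "\<lambda>u. u" z] orthonormal_D[OF onB] by auto

text \<open>
  The matrix entry of \<open>T - K\<close> between \<open>u\<close> and \<open>v j\<close> is \<open>(l u - lam j) (u \<bullet> v j)\<close>; Bessel's inequality in \<open>u\<close> bounds the sum
  of the squares of these entries by the Hilbert--Schmidt norm.
\<close>

lemma gap_sum_le:
  assumes "finite F" "F \<subseteq> J"
  shows "(\<Sum>u\<in>B. \<Sum>j\<in>F. (u \<bullet> v j)\<^sup>2 * (lam j - l u)\<^sup>2) \<le> h\<^sup>2"
proof -
  have "(u \<bullet> v j)\<^sup>2 * (lam j - l u)\<^sup>2 = (u \<bullet> (T (v j) - lam j *\<^sub>R v j))\<^sup>2" if "u \<in> B" for u j
  proof -
    have "u \<bullet> (T (v j) - lam j *\<^sub>R v j) = (l u - lam j) * (u \<bullet> v j)"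
      using sym[of u "v j"] eigen[OF that] by (simp add: inner_diff_right algebra_simps)
    thus ?thesis by (simp add: power_mult_distrib power2_commute mult.commute)
  qed
  hence "(\<Sum>u\<in>B. \<Sum>j\<in>F. (u \<bullet> v j)\<^sup>2 * (lam j - l u)\<^sup>2)
      = (\<Sum>j\<in>F. \<Sum>u\<in>B. (u \<bullet> (T (v j) - lam j *\<^sub>R v j))\<^sup>2)"
    by (subst sum.swap) simp
  also have "\<dots> \<le> (\<Sum>j\<in>F. (norm (T (v j) - lam j *\<^sub>R v j))\<^sup>2)"
    by (intro sum_mono bessel_B)
  also have "\<dots> \<le> h\<^sup>2" by (rule hs[OF assms])
  finally show ?thesis .
qed

lemma parseval_tendsto: "(\<lambda>N. \<Sum>j\<in>J \<inter> {..N}. (u \<bullet> v j) * (v j \<bullet> b)) \<longlonglongrightarrow> u \<bullet> b"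
  using tendsto_inner[OF tendsto_const expand[of b], of u]
  by (simp add: inner_sum_right mult.commute)

text \<open>
  A substitute for Weyl's inequality that needs no dimension count.  The number of eigenvectors \<open>u\<close> with \<open>l u \<ge> 2 s\<close> is
  the sum of all \<open>(u \<bullet> v j)\<^sup>2\<close>.  The indices \<open>j \<le> k\<close> contribute at most \<open>1\<close> each.  For the other ones
  \<open>lam j \<le> s\<close>, so the eigenvalues are at least \<open>s\<close> apart, and \<open>gap_sum_le\<close> leaves at most \<open>h\<^sup>2 / s\<^sup>2 \<le> 1\<close> in total.
\<close>

lemma card_large_eigenvalues_le:
  assumes s: "0 < s" "h \<le> s" and k: "\<And>j. j \<in> J \<Longrightarrow> k < j \<Longrightarrow> lam j \<le> s"
  shows "card {u \<in> B. 2 * s \<le> l u} \<le> k + 1"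
proof -
  define I where "I = {u \<in> B. 2 * s \<le> l u}"
  have I: "finite I" "I \<subseteq> B" using finB by (auto simp: I_def)
  have main: "(\<Sum>u\<in>I. \<Sum>j\<in>F. (u \<bullet> v j) * (v j \<bullet> u)) \<le> real k + 1" if F: "finite F" "F \<subseteq> J" for F
  proof -
    define F1 where "F1 = {j \<in> F. j \<le> k}"
    define F2 where "F2 = {j \<in> F. k < j}"
    have split: "F = F1 \<union> F2" "F1 \<inter> F2 = {}" "finite F1" "finite F2" "F1 \<subseteq> J" "F2 \<subseteq> J"
      using F by (auto simp: F1_def F2_def)
    have "(\<Sum>u\<in>I. \<Sum>j\<in>F1. (u \<bullet> v j)\<^sup>2) = (\<Sum>j\<in>F1. \<Sum>u\<in>I. (u \<bullet> v j)\<^sup>2)" by (rule sum.swap)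
    also have "\<dots> \<le> (\<Sum>j\<in>F1. 1)"
    proof (rule sum_mono)
      fix j assume j: "j \<in> F1"
      have "(\<Sum>u\<in>I. (u \<bullet> v j)\<^sup>2) \<le> (\<Sum>u\<in>B. (u \<bullet> v j)\<^sup>2)"
        using I finB by (intro sum_mono2) auto
      also have "\<dots> \<le> (norm (v j))\<^sup>2" by (rule bessel_B)
      also have "\<dots> = 1" using orth[of j j] j split(5) by (auto simp: power2_norm_eq_inner)
      finally show "(\<Sum>u\<in>I. (u \<bullet> v j)\<^sup>2) \<le> 1" .
    qed
    also have "\<dots> \<le> real k"
    proof -
      have "F1 \<subseteq> {1..k}" using F J_pos by (auto simp: F1_def)
      hence "card F1 \<le> card {1..k}" by (intro card_mono) auto
      thus ?thesis by simp
    qed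
    finally have p1: "(\<Sum>u\<in>I. \<Sum>j\<in>F1. (u \<bullet> v j)\<^sup>2) \<le> real k" .
    have "s\<^sup>2 * (\<Sum>u\<in>I. \<Sum>j\<in>F2. (u \<bullet> v j)\<^sup>2) = (\<Sum>u\<in>I. \<Sum>j\<in>F2. (u \<bullet> v j)\<^sup>2 * s\<^sup>2)"
      by (simp add: sum_distrib_left mult.commute)
    also have "\<dots> \<le> (\<Sum>u\<in>I. \<Sum>j\<in>F2. (u \<bullet> v j)\<^sup>2 * (lam j - l u)\<^sup>2)"
    proof (intro sum_mono mult_left_mono)
      fix u j assume "u \<in> I" "j \<in> F2"
      hence "lam j \<le> s" "2 * s \<le> l u" using k F by (auto simp: F2_def I_def)
      hence "s \<le> \<bar>lam j - l u\<bar>" by linarith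
      thus "s\<^sup>2 \<le> (lam j - l u)\<^sup>2" using s(1) by (metis abs_le_square_iff abs_of_pos)
    qed auto
    also have "\<dots> \<le> (\<Sum>u\<in>B. \<Sum>j\<in>F2. (u \<bullet> v j)\<^sup>2 * (lam j - l u)\<^sup>2)"
      using I finB by (intro sum_mono2) (auto intro!: sum_nonneg)
    also have "\<dots> \<le> h\<^sup>2" by (rule gap_sum_le[OF split(4,6)])
    also have "\<dots> \<le> s\<^sup>2 * 1" using s(2) h_nonneg by (simp add: power_mono)
    finally have p2: "(\<Sum>u\<in>I. \<Sum>j\<in>F2. (u \<bullet> v j)\<^sup>2) \<le> 1"
      using s(1) by (simp add: mult_le_cancel_left_pos)
    have "(\<Sum>u\<in>I. \<Sum>j\<in>F. (u \<bullet> v j) * (v j \<bullet> u)) = (\<Sum>u\<in>I. \<Sum>j\<in>F1 \<union> F2. (u \<bullet> v j)\<^sup>2)"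
      unfolding split(1)[symmetric] by (simp add: power2_eq_square inner_commute)
    also have "\<dots> = (\<Sum>u\<in>I. \<Sum>j\<in>F1. (u \<bullet> v j)\<^sup>2) + (\<Sum>u\<in>I. \<Sum>j\<in>F2. (u \<bullet> v j)\<^sup>2)"
      using split by (simp add: sum.union_disjoint sum.distrib)
    finally show ?thesis using p1 p2 by linarith
  qed
  have "(\<lambda>N. \<Sum>u\<in>I. \<Sum>j\<in>J \<inter> {..N}. (u \<bullet> v j) * (v j \<bullet> u)) \<longlonglongrightarrow> (\<Sum>u\<in>I. u \<bullet> u)"
    by (intro tendsto_sum parseval_tendsto)
  hence "(\<Sum>u\<in>I. u \<bullet> u) \<le> real k + 1"
    by (rule tendsto_upperbound) (auto intro!: always_eventually main)
  moreover have "(\<Sum>u\<in>I. u \<bullet> u) = (\<Sum>u\<in>I. 1)"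
    using I onB by (intro sum.cong) (auto simp: orthonormal_def)
  ultimately show ?thesis by (simp add: I_def)
qed

text \<open>
  With \<open>w j = (\<beta> \<bullet> v j) / lam j powr \<mu>\<close> the coefficient \<open>u \<bullet> \<beta>\<close> is the sum of \<open>(u \<bullet> v j) lam j\<^sup>\<mu> w j\<close>.  Replacing \<open>lam j\<close> by
  \<open>l u\<close> gives the main term, which the filter \<open>f\<close> bounds by \<open>c1 R\<close>; the difference is controlled entrywise by the
  Lipschitz constant of \<open>x\<^sup>\<mu>\<close> times \<open>\<bar>lam j - l u\<bar>\<close>, hence by \<open>gap_sum_le\<close>.  This is the Hilbert--Schmidt Lipschitz
  bound for operator functions, carried out only on the part of the spectrum of \<open>T\<close> that the filter keeps.
\<close>

lemma filtered_source_le: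
  assumes \<mu>: "1 \<le> \<mu>" and R: "0 \<le> R" and lam_le: "\<And>j. j \<in> J \<Longrightarrow> lam j \<le> \<Lambda>"
    and source: "\<And>F. finite F \<Longrightarrow> F \<subseteq> J \<Longrightarrow> (\<Sum>j\<in>F. (\<beta> \<bullet> v j)\<^sup>2 / lam j powr (2 * \<mu>)) \<le> R\<^sup>2"
    and c: "0 \<le> c1" "0 \<le> c2"
    and f: "\<And>u. u \<in> B \<Longrightarrow> f u \<noteq> 0 \<Longrightarrow>
        l u \<le> \<Lambda> \<and> l u powr (\<mu> + 1) * \<bar>f u\<bar> \<le> c1 \<and> l u * \<bar>f u\<bar> \<le> c2"
  shows "L2_set (\<lambda>u. f u * (l u * (u \<bullet> \<beta>))) B \<le> c1 * R + c2 * (\<mu> * \<Lambda> powr (\<mu> - 1)) * R * h"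
proof -
  define Lip where "Lip = \<mu> * \<Lambda> powr (\<mu> - 1)"
  have Lip0: "0 \<le> Lip" using \<mu> by (simp add: Lip_def)
  define w where "w j = (v j \<bullet> \<beta>) / lam j powr \<mu>" for j
  have main: "L2_set (\<lambda>u. f u * (l u * (\<Sum>j\<in>F. (u \<bullet> v j) * (v j \<bullet> \<beta>)))) B \<le> c1 * R + c2 * Lip * R * h"
    if F: "finite F" "F \<subseteq> J" for F
  proof -
    have w2: "(\<Sum>j\<in>F. (w j)\<^sup>2) \<le> R\<^sup>2"
    proof -
      have "(\<Sum>j\<in>F. (w j)\<^sup>2) = (\<Sum>j\<in>F. (\<beta> \<bullet> v j)\<^sup>2 / lam j powr (2 * \<mu>))"
        by (intro sum.cong) (auto simp: w_def power_divide inner_commute power2_eq_square[of "_ powr _"] powr_add[symmetric])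
      thus ?thesis using source[OF F] by simp
    qed
    hence Lw: "L2_set w F \<le> R" unfolding L2_set_def using R by (simp add: real_le_lsqrt)
    define wF where "wF = (\<Sum>j\<in>F. w j *\<^sub>R v j)"
    have nwF: "norm wF \<le> R"
    proof -
      have "(norm wF)\<^sup>2 = (\<Sum>j\<in>F. (w j)\<^sup>2)"
        unfolding wF_def using F by (intro norm_sum_orthonormal orth) auto
      thus ?thesis using w2 R by (metis power2_le_imp_le)
    qed
    \<comment> \<open>the error made by reading \<open>lam j powr \<mu>\<close> as \<open>l u powr \<mu>\<close>\<close>
    define e where "e u = (\<Sum>j\<in>F. (u \<bullet> v j) * (lam j powr \<mu> - l u powr \<mu>) * w j)" for u
    have decomp: "f u * (l u * (\<Sum>j\<in>F. (u \<bullet> v j) * (v j \<bullet> \<beta>)))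
        = l u powr (\<mu> + 1) * f u * (u \<bullet> wF) + l u * f u * e u" if "u \<in> B" for u
    proof -
      have "(\<Sum>j\<in>F. (u \<bullet> v j) * (v j \<bullet> \<beta>)) = (\<Sum>j\<in>F. (u \<bullet> v j) * (lam j powr \<mu> * w j))"
        using F lam_pos by (intro sum.cong) (auto simp: w_def less_imp_neq[symmetric] subset_eq)
      also have "\<dots> = (\<Sum>j\<in>F. l u powr \<mu> * (w j * (u \<bullet> v j)) + (u \<bullet> v j) * (lam j powr \<mu> - l u powr \<mu>) * w j)"
        by (intro sum.cong) (auto simp: algebra_simps)
      also have "\<dots> = l u powr \<mu> * (u \<bullet> wF) + e u"
        by (simp add: sum.distrib sum_distrib_left[symmetric] e_def wF_def inner_sum_right)
      finally have "l u * (\<Sum>j\<in>F. (u \<bullet> v j) * (v j \<bullet> \<beta>)) = (l u * l u powr \<mu>) * (u \<bullet> wF) + l u * e u"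
        by (simp add: distrib_left mult.assoc)
      also have "l u * l u powr \<mu> = l u powr (\<mu> + 1)"
        using powr_mult_base[OF l_nonneg[OF that], of \<mu>] by (simp add: add.commute)
      finally show ?thesis by (simp add: distrib_left mult_ac)
    qed
    have t1: "L2_set (\<lambda>u. l u powr (\<mu> + 1) * f u * (u \<bullet> wF)) B \<le> c1 * R"
    proof -
      have "L2_set (\<lambda>u. l u powr (\<mu> + 1) * f u * (u \<bullet> wF)) B
          = L2_set (\<lambda>u. \<bar>l u powr (\<mu> + 1) * f u * (u \<bullet> wF)\<bar>) B"
        by (simp add: L2_set_def)
      also have "\<dots> \<le> L2_set (\<lambda>u. c1 * \<bar>u \<bullet> wF\<bar>) B"
      proof (rule L2_set_mono)
        fix u assume "u \<in> B"
        hence "l u powr (\<mu> + 1) * \<bar>f u\<bar> \<le> c1" using f[of u] c by (cases "f u = 0") auto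
        thus "\<bar>l u powr (\<mu> + 1) * f u * (u \<bullet> wF)\<bar> \<le> c1 * \<bar>u \<bullet> wF\<bar>"
          by (simp add: abs_mult mult_right_mono)
      qed simp
      also have "\<dots> = c1 * L2_set (\<lambda>u. u \<bullet> wF) B"
        using c by (simp add: L2_set_right_distrib[symmetric]) (simp add: L2_set_def)
      also have "L2_set (\<lambda>u. u \<bullet> wF) B \<le> norm wF"
        unfolding L2_set_def using bessel_B by (simp add: real_le_lsqrt)
      finally show ?thesis using c nwF by (meson mult_left_mono order_trans)
    qed
    define E where "E u = L2_set (\<lambda>j. (u \<bullet> v j) * (lam j - l u)) F" for u
    have E: "L2_set E B \<le> h"
    proof -
      have "(\<Sum>u\<in>B. (E u)\<^sup>2) = (\<Sum>u\<in>B. \<Sum>j\<in>F. (u \<bullet> v j)\<^sup>2 * (lam j - l u)\<^sup>2)"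
        by (simp add: E_def L2_set_def sum_nonneg power_mult_distrib)
      thus ?thesis unfolding L2_set_def using gap_sum_le[OF F] h_nonneg by (simp add: real_le_lsqrt)
    qed
    have t2: "L2_set (\<lambda>u. l u * f u * e u) B \<le> c2 * Lip * R * h"
    proof -
      have "L2_set (\<lambda>u. l u * f u * e u) B = L2_set (\<lambda>u. \<bar>l u * f u * e u\<bar>) B"
        by (simp add: L2_set_def)
      also have "\<dots> \<le> L2_set (\<lambda>u. (c2 * Lip * R) * E u) B"
      proof (rule L2_set_mono)
        fix u assume u: "u \<in> B"
        show "\<bar>l u * f u * e u\<bar> \<le> c2 * Lip * R * E u"
        proof (cases "f u = 0")
          case True
          thus ?thesis using c R Lip0 by (simp add: E_def)
        next
          case False
          note fu = f[OF u False]
          have "\<bar>e u\<bar> \<le> (\<Sum>j\<in>F. \<bar>(u \<bullet> v j) * (lam j powr \<mu> - l u powr \<mu>) * w j\<bar>)"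
            unfolding e_def by (rule sum_abs)
          also have "\<dots> \<le> (\<Sum>j\<in>F. Lip * (\<bar>(u \<bullet> v j) * (lam j - l u)\<bar> * \<bar>w j\<bar>))"
          proof (rule sum_mono)
            fix j assume "j \<in> F"
            hence j: "j \<in> J" using F by auto
            have "\<bar>lam j powr \<mu> - l u powr \<mu>\<bar> \<le> Lip * \<bar>lam j - l u\<bar>"
              unfolding Lip_def using \<mu> lam_pos[OF j] lam_le[OF j] l_nonneg[OF u] fu by (intro powr_diff_le) auto
            hence "\<bar>u \<bullet> v j\<bar> * \<bar>lam j powr \<mu> - l u powr \<mu>\<bar> * \<bar>w j\<bar>
                \<le> \<bar>u \<bullet> v j\<bar> * (Lip * \<bar>lam j - l u\<bar>) * \<bar>w j\<bar>"
              by (intro mult_right_mono mult_left_mono) auto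
            thus "\<bar>(u \<bullet> v j) * (lam j powr \<mu> - l u powr \<mu>) * w j\<bar> \<le> Lip * (\<bar>(u \<bullet> v j) * (lam j - l u)\<bar> * \<bar>w j\<bar>)"
              by (simp add: abs_mult mult_ac)
          qed
          also have "\<dots> = Lip * (\<Sum>j\<in>F. \<bar>(u \<bullet> v j) * (lam j - l u)\<bar> * \<bar>w j\<bar>)"
            by (simp add: sum_distrib_left)
          also have "\<dots> \<le> Lip * (E u * L2_set w F)"
            unfolding E_def using Lip0 by (intro mult_left_mono L2_set_mult_ineq)
          also have "\<dots> \<le> Lip * (E u * R)"
            using Lip0 Lw by (intro mult_left_mono) (auto simp: E_def)
          finally have eu: "\<bar>e u\<bar> \<le> Lip * (E u * R)" .
          have "\<bar>l u * f u * e u\<bar> = (l u * \<bar>f u\<bar>) * \<bar>e u\<bar>"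
            using l_nonneg[OF u] by (simp add: abs_mult)
          also have "\<dots> \<le> c2 * (Lip * (E u * R))"
            using fu c eu l_nonneg[OF u] by (intro mult_mono) auto
          finally show ?thesis by (simp add: mult_ac)
        qed
      qed simp
      also have "\<dots> = (c2 * Lip * R) * L2_set E B"
        using c Lip0 R by (simp add: L2_set_right_distrib)
      also have "\<dots> \<le> (c2 * Lip * R) * h"
        using c Lip0 R E by (intro mult_left_mono) auto
      finally show ?thesis .
    qed
    have "L2_set (\<lambda>u. f u * (l u * (\<Sum>j\<in>F. (u \<bullet> v j) * (v j \<bullet> \<beta>)))) B
        = L2_set (\<lambda>u. l u powr (\<mu> + 1) * f u * (u \<bullet> wF) + l u * f u * e u) B"
      by (intro L2_set_cong refl decomp)
    also have "\<dots> \<le> L2_set (\<lambda>u. l u powr (\<mu> + 1) * f u * (u \<bullet> wF)) B + L2_set (\<lambda>u. l u * f u * e u) B"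
      by (rule L2_set_triangle_ineq)
    finally show ?thesis using t1 t2 by linarith
  qed
  have "(\<lambda>N. L2_set (\<lambda>u. f u * (l u * (\<Sum>j\<in>J \<inter> {..N}. (u \<bullet> v j) * (v j \<bullet> \<beta>)))) B)
      \<longlonglongrightarrow> L2_set (\<lambda>u. f u * (l u * (u \<bullet> \<beta>))) B"
    unfolding L2_set_def by (intro tendsto_intros parseval_tendsto)
  hence "L2_set (\<lambda>u. f u * (l u * (u \<bullet> \<beta>))) B \<le> c1 * R + c2 * Lip * R * h"
    by (rule tendsto_upperbound) (auto intro!: always_eventually main)
  thus ?thesis by (simp add: Lip_def)
qed

end

text \<open>
  The filter polynomial at level \<open>2 s\<close> is applied to \<open>r = (r - T \<beta>) + T \<beta>\<close>.  Its degree is at most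
  \<open>k + 1 + L d\<close> by \<open>card_large_eigenvalues_le\<close>; the exponent \<open>L \<ge> \<mu> + 1\<close> makes the damping effective up to the power
  \<open>x\<^sup>\<mu>\<^sup>+\<^sup>1\<close> that the source condition provides.
\<close>

lemma (in eigenbasis) pls_residual_le:
  fixes x :: "nat \<Rightarrow> 'a" and y :: "nat \<Rightarrow> real"
  assumes \<mu>: "1 \<le> \<mu>" and R: "0 \<le> R"
    and source: "\<And>F. finite F \<Longrightarrow> F \<subseteq> J \<Longrightarrow> (\<Sum>j\<in>F. (\<beta> \<bullet> v j)\<^sup>2 / lam j powr (2 * \<mu>)) \<le> R\<^sup>2"
    and h: "0 \<le> h" "\<And>F. finite F \<Longrightarrow> F \<subseteq> J \<Longrightarrow> (\<Sum>j\<in>F. (norm (emp_K n x (v j) - lam j *\<^sub>R v j))\<^sup>2) \<le> h\<^sup>2"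
    and noise: "norm (emp_r n x y - emp_K n x \<beta>) \<le> \<Delta>"
    and s: "0 < s" "h \<le> s" and k: "\<And>j. j \<in> J \<Longrightarrow> k < j \<Longrightarrow> lam j \<le> s"
    and \<Lambda>: "\<And>j. j \<in> J \<Longrightarrow> lam j \<le> \<Lambda>" "2 * s \<le> \<Lambda>"
    and d: "1 \<le> d" and L: "\<mu> + 1 \<le> real L"
  shows "norm (emp_r n x y - emp_K n x (pls n x y (k + 1 + L * d)))
      \<le> \<Delta> + ((2 * s / (real d)\<^sup>2) powr (\<mu> + 1) * R
             + 2 * s / (real d)\<^sup>2 * (\<mu> * \<Lambda> powr (\<mu> - 1)) * R * h)"
proof -
  let ?T = "emp_K n x" and ?r = "emp_r n x y"
  obtain B l where B: "finite B" "orthonormal B" "span B = span (x ` {1..n})"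
      "\<And>u. u \<in> B \<Longrightarrow> ?T u = l u *\<^sub>R u"
    using spectral_theorem_finite[OF bounded_linear_emp_K emp_K_symmetric, of "x ` {1..n}" n x]
      emp_K_in_span by (metis finite_atLeastAtMost finite_imageI)
  have lnn: "0 \<le> l u" if "u \<in> B" for u
    using emp_K_nonneg[of u n x] B(4)[OF that] orthonormal_D[OF B(2) that that] by simp
  interpret perturbed_eigenbasis J lam v ?T B l h
    by unfold_locales (use B lnn h emp_K_symmetric in auto)
  define I where "I = {u \<in> B. 2 * s \<le> l u}"
  have cI: "card I \<le> k + 1" unfolding I_def by (rule card_large_eigenvalues_le[OF s k])
  have "1 \<le> L" using L \<mu> by linarith
  obtain p where p: "degree p \<le> card I + L * d" "poly p 0 = 1"
    "\<And>u. u \<in> I \<Longrightarrow> poly p (l u) = 0"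
    "\<And>x. 0 \<le> x \<Longrightarrow> x < 2 * s \<Longrightarrow> \<bar>poly p x\<bar> \<le> 1"
    "\<And>x a. 0 \<le> x \<Longrightarrow> x < 2 * s \<Longrightarrow> 1 \<le> a \<Longrightarrow> a \<le> real L \<Longrightarrow>
       x powr a * \<bar>poly p x\<bar> \<le> (2 * s / (real d)\<^sup>2) powr a"
    by (rule filter_polynomial[of I "2 * s" l d L])
      (use B(1) s d \<open>1 \<le> L\<close> in \<open>auto simp: I_def\<close>)
  define f where "f u = poly p (l u)" for u
  have small: "l u < 2 * s" if "u \<in> B" "f u \<noteq> 0" for u
    using p(3)[of u] that by (force simp: I_def f_def)
  have f1: "\<bar>f u\<bar> \<le> 1" if "u \<in> B" for u
    using small[OF that] p(4)[of "l u"] l_nonneg[OF that] by (cases "f u = 0") (auto simp: f_def)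
  define z where "z = op_poly p ?T ?r"
  have zB: "z \<in> span B"
    unfolding z_def B(3) by (rule op_poly_in_invariant_subspace[OF subspace_span emp_K_in_span emp_r_in_span])
  have uz: "u \<bullet> z = f u * (u \<bullet> (?r - ?T \<beta>)) + f u * (l u * (u \<bullet> \<beta>))" if "u \<in> B" for u
  proof -
    have "u \<bullet> z = f u * (u \<bullet> ?r)" unfolding z_def f_def
      by (rule inner_op_poly_eigenvector[OF sym eigen[OF that]])
    moreover have "u \<bullet> ?T \<beta> = l u * (u \<bullet> \<beta>)" using sym[of u \<beta>] eigen[OF that] by simp
    ultimately show ?thesis by (simp add: inner_diff_right algebra_simps)
  qed
  have "norm z = L2_set (\<lambda>u. u \<bullet> z) B"
    unfolding L2_set_def using parseval_finite[OF B(1,2) zB]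
    by (metis norm_ge_zero real_sqrt_abs abs_of_nonneg)
  also have "\<dots> = L2_set (\<lambda>u. f u * (u \<bullet> (?r - ?T \<beta>)) + f u * (l u * (u \<bullet> \<beta>))) B"
    by (intro L2_set_cong refl uz)
  also have "\<dots> \<le> L2_set (\<lambda>u. f u * (u \<bullet> (?r - ?T \<beta>))) B + L2_set (\<lambda>u. f u * (l u * (u \<bullet> \<beta>))) B"
    by (rule L2_set_triangle_ineq)
  also have "L2_set (\<lambda>u. f u * (u \<bullet> (?r - ?T \<beta>))) B \<le> \<Delta>"
  proof -
    have "(\<Sum>u\<in>B. (f u * (u \<bullet> (?r - ?T \<beta>)))\<^sup>2) \<le> (\<Sum>u\<in>B. (u \<bullet> (?r - ?T \<beta>))\<^sup>2)"
    proof (rule sum_mono)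
      fix u assume "u \<in> B"
      from f1[OF this] show "(f u * (u \<bullet> (?r - ?T \<beta>)))\<^sup>2 \<le> (u \<bullet> (?r - ?T \<beta>))\<^sup>2"
        by (simp add: power_mult_distrib mult_left_le_one_le abs_square_le_1)
    qed
    also have "\<dots> \<le> (norm (?r - ?T \<beta>))\<^sup>2" by (rule bessel_B)
    finally have "L2_set (\<lambda>u. f u * (u \<bullet> (?r - ?T \<beta>))) B \<le> norm (?r - ?T \<beta>)"
      unfolding L2_set_def by (simp add: real_le_lsqrt)
    thus ?thesis using noise by simp
  qed
  also have "L2_set (\<lambda>u. f u * (l u * (u \<bullet> \<beta>))) B
      \<le> (2 * s / (real d)\<^sup>2) powr (\<mu> + 1) * R + 2 * s / (real d)\<^sup>2 * (\<mu> * \<Lambda> powr (\<mu> - 1)) * R * h"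
  proof (rule filtered_source_le[OF \<mu> R \<Lambda>(1) source])
    fix u assume u: "u \<in> B" "f u \<noteq> 0"
    note sm = small[OF u] and nn = l_nonneg[OF u(1)]
    show "l u \<le> \<Lambda> \<and> l u powr (\<mu> + 1) * \<bar>f u\<bar> \<le> (2 * s / (real d)\<^sup>2) powr (\<mu> + 1) \<and>
        l u * \<bar>f u\<bar> \<le> 2 * s / (real d)\<^sup>2"
      using p(5)[OF nn sm, of "\<mu> + 1"] p(5)[OF nn sm, of 1] sm \<Lambda>(2) \<mu> L nn s by (simp add: f_def)
  qed (use s in auto)
  finally have "norm z \<le> \<Delta> + ((2 * s / (real d)\<^sup>2) powr (\<mu> + 1) * R
             + 2 * s / (real d)\<^sup>2 * (\<mu> * \<Lambda> powr (\<mu> - 1)) * R * h)" by linarith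
  moreover have "norm (?r - ?T (pls n x y (k + 1 + L * d))) \<le> norm z"
    unfolding z_def using p(1,2) cI by (intro pls_residual_le_op_poly) auto
  ultimately show ?thesis by linarith
qed

section \<open>Rates for the stopping index\<close>

text \<open>
  An asymptotic bound by a positive sequence holds from the first index on, after enlarging the constant by the
  finitely many exceptional quotients.
\<close>

lemma bigo_imp_bound_everywhere:
  fixes f g :: "nat \<Rightarrow> real"
  assumes "f \<in> O(g)" and pos: "\<And>j. 1 \<le> j \<Longrightarrow> 0 < g j"
  obtains A where "0 < A" "\<And>j. 1 \<le> j \<Longrightarrow> f j \<le> A * g j"
proof -
  obtain c where c: "c > 0" "eventually (\<lambda>j. norm (f j) \<le> c * norm (g j)) at_top"
    using assms(1) by (elim landau_o.bigE)
  then obtain j0 where j0: "\<And>j. j \<ge> j0 \<Longrightarrow> norm (f j) \<le> c * norm (g j)"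
    by (auto simp: eventually_at_top_linorder)
  define s where "s = (\<Sum>i=1..j0. \<bar>f i\<bar> / g i)"
  have s0: "0 \<le> s" unfolding s_def using pos by (intro sum_nonneg) (auto intro!: divide_nonneg_pos)
  have "f j \<le> (c + s) * g j" if "1 \<le> j" for j
  proof (cases "j \<ge> j0")
    case True
    have "f j \<le> c * g j" using j0[OF True] pos[OF that] by simp
    also have "\<dots> \<le> (c + s) * g j" using s0 pos[OF that] by (intro mult_right_mono) auto
    finally show ?thesis .
  next
    case False
    have "\<bar>f j\<bar> / g j \<le> s"
      unfolding s_def using that False pos
      by (intro member_le_sum[where f = "\<lambda>i. \<bar>f i\<bar> / g i"]) (auto intro!: divide_nonneg_pos)
    hence "\<bar>f j\<bar> \<le> s * g j" using pos[OF that] by (simp add: pos_divide_le_eq)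
    also have "\<dots> \<le> (c + s) * g j" using c(1) pos[OF that] by (intro mult_right_mono) auto
    finally show ?thesis by linarith
  qed
  thus ?thesis using that[of "c + s"] c(1) s0 by simp
qed

lemma pls_stop_le:
  assumes "norm (emp_r n x y - emp_K n x (pls n x y m)) \<le> t"
  shows "pls_stop n x y t \<le> m"
  unfolding pls_stop_def using assms by (rule Least_le)

context eigenbasis begin

text \<open>
  The two deterministic properties of a sample from which the bounds on the stopping index follow: small noise and a
  small Hilbert--Schmidt distance of the covariance operators, the latter through finite partial sums.
\<close>

definition close_data :: "'a \<Rightarrow> real \<Rightarrow> real \<Rightarrow> nat \<Rightarrow> (nat \<Rightarrow> 'a) \<Rightarrow> (nat \<Rightarrow> real) \<Rightarrow> bool" where
  "close_data \<beta> \<Delta> h n x y \<longleftrightarrow> norm (emp_r n x y - emp_K n x \<beta>) \<le> \<Delta> \<and>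
     (\<forall>F. finite F \<longrightarrow> F \<subseteq> J \<longrightarrow> (\<Sum>j\<in>F. (norm (emp_K n x (v j) - lam j *\<^sub>R v j))\<^sup>2) \<le> h\<^sup>2)"

end

text \<open>
  \<open>D0\<close> and \<open>B0\<close> are the scales of the noise and of the covariance error: for \<open>N = n \<delta>\<close> these errors are at most
  \<open>D0 / sqrt N\<close> and \<open>B0 / sqrt N\<close>.
\<close>

locale source_condition = eigenbasis +
  fixes \<beta> :: 'a and \<mu> R C \<tau> D0 B0 :: real
  assumes \<mu>: "1 \<le> \<mu>" and R: "0 < R" and C: "\<And>j. j \<in> J \<Longrightarrow> lam j \<le> C"
    and source: "\<And>F. finite F \<Longrightarrow> F \<subseteq> J \<Longrightarrow> (\<Sum>j\<in>F. (\<beta> \<bullet> v j)\<^sup>2 / lam j powr (2 * \<mu>)) \<le> R\<^sup>2"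
    and \<tau>: "1 < \<tau>" and D0: "0 < D0" and B0: "0 \<le> B0"
begin

text \<open>
  Both decay regimes in one statement.  The level is \<open>s = A g\<close> and the Fejer degree \<open>d0 M\<close>, where \<open>d0\<close> depends only on the
  constants of the problem.  The hypotheses on \<open>g\<close> say that \<open>s\<close> dominates the covariance error and that
  \<open>(g / M\<^sup>2)\<^sup>\<mu>\<^sup>+\<^sup>1\<close> is at most the noise level; the remaining multiplicative constants are beaten by choosing \<open>d0\<close> large rather than
  \<open>N\<close> large, and the bound holds from \<open>N = 1\<close> on.
\<close>

lemma stopping_bound:
  assumes A: "0 < A" "B0 \<le> A"
  obtains d :: nat where "\<And>N g M k n x y. 1 \<le> N \<Longrightarrow> N powr (-1/2) \<le> g \<Longrightarrow> g \<le> 1 \<Longrightarrow> 1 \<le> M \<Longrightarrow>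
    (g / (real M)\<^sup>2) powr (\<mu> + 1) \<le> N powr (-1/2) \<Longrightarrow>
    (\<And>j. j \<in> J \<Longrightarrow> k < j \<Longrightarrow> lam j \<le> A * g) \<Longrightarrow>
    close_data \<beta> (D0 * N powr (-1/2)) (B0 * N powr (-1/2)) n x y \<Longrightarrow>
    pls_stop n x y (\<tau> * (D0 * N powr (-1/2))) \<le> k + 1 + d * M"
proof -
  define L where "L = nat \<lceil>\<mu> + 1\<rceil>"
  have L: "\<mu> + 1 \<le> real L" unfolding L_def using \<mu> by linarith
  define \<Lambda> where "\<Lambda> = max C (2 * A)"
  define Q where "Q = R + \<mu> * \<Lambda> powr (\<mu> - 1) * R * B0"
  have Q0: "0 < Q" unfolding Q_def using R \<mu> B0 by (intro add_pos_nonneg) auto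
  \<comment> \<open>large enough for \<open>\<eta> = 2 A / d0\<^sup>2\<close> to satisfy \<open>\<eta> \<le> 1\<close> and \<open>\<eta> Q \<le> (\<tau> - 1) D0\<close>\<close>
  define d0 where "d0 = nat \<lceil>max (2 * A) (2 * A * Q / ((\<tau> - 1) * D0))\<rceil> + 1"
  have d0: "1 \<le> d0" "2 * A \<le> real d0" "2 * A * Q / ((\<tau> - 1) * D0) \<le> real d0"
    unfolding d0_def by linarith+
  define \<eta> where "\<eta> = 2 * A / (real d0)\<^sup>2"
  have sq: "real d0 \<le> (real d0)\<^sup>2" using d0(1) by (simp add: power2_eq_square)
  have \<eta>: "0 < \<eta>" "\<eta> \<le> 1" "\<eta> * Q \<le> (\<tau> - 1) * D0"
  proof -
    show "0 < \<eta>" unfolding \<eta>_def using A d0(1) by simp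
    have "2 * A \<le> (real d0)\<^sup>2" using d0(2) sq by linarith
    thus "\<eta> \<le> 1" unfolding \<eta>_def using d0(1) by (subst divide_le_eq_1_pos) auto
    have p: "0 < (\<tau> - 1) * D0" using \<tau> D0 by simp
    have "2 * A * Q \<le> real d0 * ((\<tau> - 1) * D0)" using d0(3) by (subst (asm) pos_divide_le_eq[OF p])
    also have "\<dots> \<le> (real d0)\<^sup>2 * ((\<tau> - 1) * D0)" using sq p by (intro mult_right_mono) auto
    finally have "2 * A * Q \<le> (\<tau> - 1) * D0 * (real d0)\<^sup>2" by (simp add: mult.commute)
    thus "\<eta> * Q \<le> (\<tau> - 1) * D0" unfolding \<eta>_def using d0(1) by (simp add: pos_divide_le_eq)
  qed
  have "pls_stop n x y (\<tau> * (D0 * N powr (-1/2))) \<le> k + 1 + (L * d0) * M"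
    if N: "1 \<le> N" and g: "N powr (-1/2) \<le> g" "g \<le> 1" and M: "1 \<le> M"
      and gM: "(g / (real M)\<^sup>2) powr (\<mu> + 1) \<le> N powr (-1/2)"
      and k: "\<And>j. j \<in> J \<Longrightarrow> k < j \<Longrightarrow> lam j \<le> A * g"
      and close: "close_data \<beta> (D0 * N powr (-1/2)) (B0 * N powr (-1/2)) n x y"
    for N g M k n x y
  proof -
    define e where "e = N powr (-1/2)"
    have e: "0 < e" "e \<le> g" using N g by (auto simp: e_def)
    have c: "2 * (A * g) / (real (d0 * M))\<^sup>2 = \<eta> * (g / (real M)\<^sup>2)"
      by (simp add: \<eta>_def power_mult_distrib)
    have gM1: "0 \<le> g / (real M)\<^sup>2" "g / (real M)\<^sup>2 \<le> 1"
      using e g(2) M by (auto simp: divide_le_eq_1 intro: order_trans[of _ 1])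
    have "norm (emp_r n x y - emp_K n x (pls n x y (k + 1 + L * (d0 * M))))
      \<le> D0 * e + ((2 * (A * g) / (real (d0 * M))\<^sup>2) powr (\<mu> + 1) * R
             + 2 * (A * g) / (real (d0 * M))\<^sup>2 * (\<mu> * \<Lambda> powr (\<mu> - 1)) * R * (B0 * e))"
    proof (rule pls_residual_le[OF \<mu> less_imp_le[OF R] source])
      show "0 \<le> B0 * e" using B0 e by simp
      show "(\<Sum>j\<in>F. (norm (emp_K n x (v j) - lam j *\<^sub>R v j))\<^sup>2) \<le> (B0 * e)\<^sup>2"
        if "finite F" "F \<subseteq> J" for F using close that by (simp add: close_data_def e_def)
      show "norm (emp_r n x y - emp_K n x \<beta>) \<le> D0 * e" using close by (simp add: close_data_def e_def)
      show "0 < A * g" using A e by simp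
      show "B0 * e \<le> A * g" using A B0 e by (intro mult_mono) auto
      show "lam j \<le> A * g" if "j \<in> J" "k < j" for j using k that by blast
      show "lam j \<le> \<Lambda>" if "j \<in> J" for j using C[OF that] by (simp add: \<Lambda>_def)
      have "A * g \<le> A * 1" using A g by (intro mult_left_mono) auto
      thus "2 * (A * g) \<le> \<Lambda>" by (simp add: \<Lambda>_def)
      show "1 \<le> d0 * M" using d0(1) M by simp
      show "\<mu> + 1 \<le> real L" by (rule L)
    qed auto
    also have "\<dots> \<le> D0 * e + (\<eta> * e * R + \<eta> * (\<mu> * \<Lambda> powr (\<mu> - 1)) * R * (B0 * e))"
    proof (intro add_mono order_refl)
      have "(\<eta> * (g / (real M)\<^sup>2)) powr (\<mu> + 1) = \<eta> powr (\<mu> + 1) * (g / (real M)\<^sup>2) powr (\<mu> + 1)"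
        by (rule powr_mult)
      also have "\<dots> \<le> \<eta> powr 1 * e"
        using \<eta> \<mu> gM by (intro mult_mono powr_mono') (auto simp: e_def)
      finally have "(\<eta> * (g / (real M)\<^sup>2)) powr (\<mu> + 1) \<le> \<eta> * e" using \<eta>(1) by simp
      thus "(2 * (A * g) / (real (d0 * M))\<^sup>2) powr (\<mu> + 1) * R \<le> \<eta> * e * R"
        unfolding c using R by simp
      have "\<eta> * (g / (real M)\<^sup>2) \<le> \<eta>" using mult_left_mono[OF gM1(2), of \<eta>] \<eta>(1) by simp
      thus "2 * (A * g) / (real (d0 * M))\<^sup>2 * (\<mu> * \<Lambda> powr (\<mu> - 1)) * R * (B0 * e)
          \<le> \<eta> * (\<mu> * \<Lambda> powr (\<mu> - 1)) * R * (B0 * e)"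
        unfolding c using \<mu> R B0 e by (intro mult_right_mono) auto
    qed
    also have "\<dots> = D0 * e + \<eta> * Q * e" by (simp add: Q_def algebra_simps)
    also have "\<dots> \<le> D0 * e + (\<tau> - 1) * D0 * e" using \<eta>(3) e by simp
    also have "\<dots> = \<tau> * (D0 * e)" by (simp add: algebra_simps)
    finally show ?thesis unfolding e_def by (intro pls_stop_le) (simp add: mult_ac)
  qed
  thus ?thesis using that[of "L * d0"] by blast
qed

text \<open>
  The choices are \<open>k = M = \<lceil>N\<^sup>\<theta>\<rceil>\<close> and \<open>g = N\<^sup>-\<^sup>2\<^sup>\<kappa>\<^sup>\<theta>\<close>, so that \<open>g / M\<^sup>2\<close> is at most \<open>N\<close> to the power
  \<open>- 2 (\<kappa> + 1) \<theta>\<close>.  The exponent \<open>\<theta>\<close> solves \<open>2 (\<kappa> + 1) \<theta> (\<mu> + 1) = 1/2\<close>.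
\<close>

lemma polynomial_rate:
  assumes \<kappa>: "0 < \<kappa>" and lam: "lam \<in> O(\<lambda>j. real j powr (- 2 * \<kappa>))"
  shows "\<exists>c\<ge>0. \<forall>N n x y. 1 \<le> N \<longrightarrow> close_data \<beta> (D0 * N powr (-1/2)) (B0 * N powr (-1/2)) n x y \<longrightarrow>
    real (pls_stop n x y (\<tau> * (D0 * N powr (-1/2)))) \<le> c * N powr (1 / (4 * (\<kappa> + 1) * (\<mu> + 1)))"
proof -
  obtain A1 where A1: "0 < A1" "\<And>j. 1 \<le> j \<Longrightarrow> lam j \<le> A1 * real j powr (- 2 * \<kappa>)"
    using bigo_imp_bound_everywhere[OF lam] by auto
  define A where "A = max A1 B0"
  have A: "0 < A" "B0 \<le> A" "A1 \<le> A" using A1 by (auto simp: A_def)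
  obtain d where d: "\<And>N g M k n x y. 1 \<le> N \<Longrightarrow> N powr (-1/2) \<le> g \<Longrightarrow> g \<le> 1 \<Longrightarrow> 1 \<le> M \<Longrightarrow>
    (g / (real M)\<^sup>2) powr (\<mu> + 1) \<le> N powr (-1/2) \<Longrightarrow>
    (\<And>j. j \<in> J \<Longrightarrow> k < j \<Longrightarrow> lam j \<le> A * g) \<Longrightarrow>
    close_data \<beta> (D0 * N powr (-1/2)) (B0 * N powr (-1/2)) n x y \<Longrightarrow>
    pls_stop n x y (\<tau> * (D0 * N powr (-1/2))) \<le> k + 1 + d * M"
    using stopping_bound[OF A(1,2)] by metis
  define \<theta> where "\<theta> = 1 / (4 * (\<kappa> + 1) * (\<mu> + 1))"
  have \<theta>: "0 < \<theta>" using \<kappa> \<mu> by (simp add: \<theta>_def)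
  have \<theta>1: "2 * (\<kappa> + 1) * \<theta> * (\<mu> + 1) = 1 / 2" using \<kappa> \<mu> by (simp add: \<theta>_def)
  have \<theta>2: "2 * \<kappa> * \<theta> \<le> 1 / 2"
  proof -
    have "2 * \<kappa> * \<theta> * 1 \<le> 2 * (\<kappa> + 1) * \<theta> * (\<mu> + 1)"
      using \<kappa> \<theta> \<mu> by (intro mult_mono) auto
    thus ?thesis using \<theta>1 by simp
  qed
  have "real (pls_stop n x y (\<tau> * (D0 * N powr (-1/2)))) \<le> (2 * (2 + real d)) * N powr \<theta>"
    if N: "1 \<le> N" and close: "close_data \<beta> (D0 * N powr (-1/2)) (B0 * N powr (-1/2)) n x y" for N n x y
  proof -
    define k where "k = nat \<lceil>N powr \<theta>\<rceil>"
    have N\<theta>: "1 \<le> N powr \<theta>" using N \<theta> by (simp add: ge_one_powr_ge_zero)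
    have k: "1 \<le> k" "N powr \<theta> \<le> real k" "real k \<le> 2 * N powr \<theta>"
      unfolding k_def using N\<theta> by linarith+
    define g where "g = N powr (- (2 * \<kappa> * \<theta>))"
    have "pls_stop n x y (\<tau> * (D0 * N powr (-1/2))) \<le> k + 1 + d * k"
    proof (rule d[OF N _ _ k(1) _ _ close])
      show "N powr (-1/2) \<le> g" unfolding g_def using N \<theta>2 by (intro powr_mono) auto
      show "g \<le> 1" unfolding g_def using N \<kappa> \<theta> powr_mono[of "- (2 * \<kappa> * \<theta>)" 0 N] by simp
      have "g / (real k)\<^sup>2 \<le> g / (N powr \<theta>)\<^sup>2"
        using k N\<theta> by (intro divide_left_mono power_mono mult_pos_pos zero_less_power) (auto simp: g_def)
      also have "\<dots> = N powr (- (2 * (\<kappa> + 1) * \<theta>))"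
      proof -
        have "g / (N powr \<theta>)\<^sup>2 = N powr (- (2 * \<kappa> * \<theta>) - (\<theta> + \<theta>))"
          by (simp only: g_def power2_eq_square powr_add[symmetric] powr_diff[symmetric])
        also have "- (2 * \<kappa> * \<theta>) - (\<theta> + \<theta>) = - (2 * (\<kappa> + 1) * \<theta>)" by (simp add: algebra_simps)
        finally show ?thesis .
      qed
      finally have "(g / (real k)\<^sup>2) powr (\<mu> + 1) \<le> (N powr (- (2 * (\<kappa> + 1) * \<theta>))) powr (\<mu> + 1)"
        using \<mu> by (intro powr_mono2) (auto simp: g_def)
      also have "\<dots> = N powr (-1/2)"
      proof -
        \<comment> \<open>the defining equation of \<open>\<theta>\<close>\<close>
        have e: "- (2 * (\<kappa> + 1) * \<theta>) * (\<mu> + 1) = -1/2" by (simp only: mult_minus_left \<theta>1)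
        show ?thesis by (simp only: powr_powr e)
      qed
      finally show "(g / (real k)\<^sup>2) powr (\<mu> + 1) \<le> N powr (-1/2)" .
      show "lam j \<le> A * g" if "j \<in> J" "k < j" for j
      proof -
        have j: "1 \<le> j" "N powr \<theta> \<le> real j" using that k by auto
        have "lam j \<le> A1 * real j powr (- 2 * \<kappa>)" by (rule A1(2)[OF j(1)])
        also have "\<dots> \<le> A * (N powr \<theta>) powr (- 2 * \<kappa>)"
          using A A1(1) j N\<theta> \<kappa> by (intro mult_mono powr_mono2') auto
        also have "(N powr \<theta>) powr (- 2 * \<kappa>) = g" by (simp add: g_def powr_powr mult_ac)
        finally show ?thesis .
      qed
    qed
    hence "real (pls_stop n x y (\<tau> * (D0 * N powr (-1/2)))) \<le> real (k + 1 + d * k)"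
      by (simp only: of_nat_le_iff)
    also have "\<dots> \<le> (2 + real d) * real k" using k(1) by (simp add: algebra_simps)
    also have "\<dots> \<le> (2 + real d) * (2 * N powr \<theta>)" using k(3) by (intro mult_left_mono) auto
    also have "\<dots> = (2 * (2 + real d)) * N powr \<theta>" by simp
    finally show ?thesis .
  qed
  thus ?thesis unfolding \<theta>_def by (intro exI[of _ "2 * (2 + real d)"]) auto
qed

text \<open>
  The choices are \<open>M = 1\<close>, \<open>g = N\<^sup>-\<^sup>b\<close> with \<open>b (\<mu> + 1) = 1/2\<close>, and \<open>k = \<lceil>a ln N\<rceil>\<close> with \<open>q\<^sup>a = e\<^sup>-\<^sup>b\<close>.  The
  additive constants are absorbed because \<open>ln N \<ge> 1\<close>.
\<close>

lemma exponential_rate: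
  assumes q: "0 < q" "q < 1" and lam: "lam \<in> O(\<lambda>j. q ^ j)"
  shows "\<exists>c\<ge>0. \<forall>N n x y. exp 1 \<le> N \<longrightarrow> close_data \<beta> (D0 * N powr (-1/2)) (B0 * N powr (-1/2)) n x y \<longrightarrow>
    real (pls_stop n x y (\<tau> * (D0 * N powr (-1/2)))) \<le> c * ln N"
proof -
  obtain A1 where A1: "0 < A1" "\<And>j. 1 \<le> j \<Longrightarrow> lam j \<le> A1 * q ^ j"
    using bigo_imp_bound_everywhere[OF lam] q by auto
  define A where "A = max A1 B0"
  have A: "0 < A" "B0 \<le> A" "A1 \<le> A" using A1 by (auto simp: A_def)
  obtain d where d: "\<And>N g M k n x y. 1 \<le> N \<Longrightarrow> N powr (-1/2) \<le> g \<Longrightarrow> g \<le> 1 \<Longrightarrow> 1 \<le> M \<Longrightarrow>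
    (g / (real M)\<^sup>2) powr (\<mu> + 1) \<le> N powr (-1/2) \<Longrightarrow>
    (\<And>j. j \<in> J \<Longrightarrow> k < j \<Longrightarrow> lam j \<le> A * g) \<Longrightarrow>
    close_data \<beta> (D0 * N powr (-1/2)) (B0 * N powr (-1/2)) n x y \<Longrightarrow>
    pls_stop n x y (\<tau> * (D0 * N powr (-1/2))) \<le> k + 1 + d * M"
    using stopping_bound[OF A(1,2)] by metis
  define b where "b = 1 / (2 * (\<mu> + 1))"
  have b: "0 < b" "b \<le> 1 / 2" "b * (\<mu> + 1) = 1 / 2" using \<mu> by (auto simp: b_def field_simps)
  define a where "a = b / (- ln q)"
  have lq: "ln q < 0" using q by simp
  have a: "0 < a" "a * ln q = - b" unfolding a_def using b lq by (auto simp: divide_pos_neg)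
  have "real (pls_stop n x y (\<tau> * (D0 * N powr (-1/2)))) \<le> (a + 2 + real d) * ln N"
    if N: "exp 1 \<le> N" and close: "close_data \<beta> (D0 * N powr (-1/2)) (B0 * N powr (-1/2)) n x y" for N n x y
  proof -
    have N1: "1 \<le> N" using N one_le_exp_iff[of "1::real"] by linarith
    have lN: "1 \<le> ln N" using N N1 by (simp add: ln_ge_iff)
    define k where "k = nat \<lceil>a * ln N\<rceil>"
    have k: "a * ln N \<le> real k" "real k \<le> a * ln N + 1"
      unfolding k_def using a lN mult_nonneg_nonneg[of a "ln N"] by linarith+
    define g where "g = N powr (- b)"
    have "pls_stop n x y (\<tau> * (D0 * N powr (-1/2))) \<le> k + 1 + d * 1"
    proof (rule d[OF N1 _ _ le_refl _ _ close])
      show "N powr (-1/2) \<le> g" unfolding g_def using N1 b by (intro powr_mono) auto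
      show "g \<le> 1" unfolding g_def using N1 b powr_mono[of "- b" 0 N] by simp
      show "(g / (real 1)\<^sup>2) powr (\<mu> + 1) \<le> N powr (-1/2)"
        by (simp add: g_def powr_powr b(3))
      show "lam j \<le> A * g" if "j \<in> J" "k < j" for j
      proof -
        have j: "1 \<le> j" "a * ln N \<le> real j" using that k by auto
        have "q ^ j = exp (real j * ln q)" using q by (simp add: exp_of_nat_mult)
        also have "\<dots> \<le> exp (a * ln N * ln q)" using j lq by (simp add: mult_right_mono_neg)
        also have "a * ln N * ln q = - b * ln N" using a(2) by (metis mult.assoc mult.commute)
        also have "exp (- b * ln N) = g" using N1 by (simp add: g_def powr_def)
        finally have "A1 * q ^ j \<le> A * g" using A A1(1) q by (intro mult_mono) auto
        thus ?thesis using A1(2)[OF j(1)] by linarith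
      qed
    qed
    hence "real (pls_stop n x y (\<tau> * (D0 * N powr (-1/2)))) \<le> real k + 1 + real d" by linarith
    also have "\<dots> \<le> a * ln N + 2 * 1 + real d * 1" using k(2) by simp
    also have "\<dots> \<le> a * ln N + 2 * ln N + real d * ln N"
      using lN a(1) by (intro add_mono mult_left_mono) auto
    finally show ?thesis by (simp add: algebra_simps)
  qed
  thus ?thesis using a by (intro exI[of _ "a + 2 + real d"]) auto
qed

end

section \<open>Second moments of means of independent vectors\<close>

text \<open>
  Fubini's theorem on the joint law, which is a product law by independence.
\<close>

lemma (in prob_space) indep_inner_expectation:
  fixes Z1 Z2 :: "'a \<Rightarrow> 'h::{real_inner,banach,second_countable_topology}"
  assumes ind: "indep_var borel Z1 borel Z2" and int: "integrable M Z1" "integrable M Z2"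
    "integrable M (\<lambda>\<omega>. Z1 \<omega> \<bullet> Z2 \<omega>)"
  shows "(\<integral>\<omega>. Z1 \<omega> \<bullet> Z2 \<omega> \<partial>M) = (\<integral>\<omega>. Z1 \<omega> \<partial>M) \<bullet> (\<integral>\<omega>. Z2 \<omega> \<partial>M)"
proof -
  let ?D1 = "distr M borel Z1" and ?D2 = "distr M borel Z2"
  have rv[measurable]: "Z1 \<in> borel_measurable M" "Z2 \<in> borel_measurable M" using int by auto
  have eq: "?D1 \<Otimes>\<^sub>M ?D2 = distr M (borel \<Otimes>\<^sub>M borel) (\<lambda>\<omega>. (Z1 \<omega>, Z2 \<omega>))"
    using ind by (simp add: indep_var_distribution_eq)
  interpret D1: prob_space ?D1 by (rule prob_space_distr) fact
  interpret D2: prob_space ?D2 by (rule prob_space_distr) fact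
  interpret pair_sigma_finite ?D1 ?D2 ..
  have m[measurable]: "(\<lambda>p. fst p \<bullet> snd p :: real) \<in> borel_measurable (borel \<Otimes>\<^sub>M (borel :: 'h measure))"
    by simp
  have pm: "(\<lambda>\<omega>. (Z1 \<omega>, Z2 \<omega>)) \<in> M \<rightarrow>\<^sub>M borel \<Otimes>\<^sub>M borel" by simp
  have integ: "integrable (?D1 \<Otimes>\<^sub>M ?D2) (\<lambda>p. fst p \<bullet> snd p)"
    unfolding eq using int(3) by (subst integrable_distr_eq[OF pm m]) simp
  have "(\<integral>\<omega>. Z1 \<omega> \<bullet> Z2 \<omega> \<partial>M) = (\<integral>p. fst p \<bullet> snd p \<partial>(?D1 \<Otimes>\<^sub>M ?D2))"
    unfolding eq by (subst integral_distr[OF pm m]) simp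
  also have "\<dots> = (\<integral>a. (\<integral>b. a \<bullet> b \<partial>?D2) \<partial>?D1)"
    using integral_fst'[OF integ] by simp
  also have "\<dots> = (\<integral>a. a \<bullet> (\<integral>\<omega>. Z2 \<omega> \<partial>M) \<partial>?D1)"
    using int(2) by (intro Bochner_Integration.integral_cong refl)
      (subst integral_distr, auto)
  also have "\<dots> = (\<integral>\<omega>. Z1 \<omega> \<partial>M) \<bullet> (\<integral>\<omega>. Z2 \<omega> \<partial>M)"
    using int(1) by (subst integral_distr) auto
  finally show ?thesis .
qed

lemma integrable_of_square_integrable:
  fixes Z :: "'p \<Rightarrow> 'h::{banach,second_countable_topology}"
  assumes "finite_measure M" "Z \<in> borel_measurable M" "integrable M (\<lambda>\<omega>. (norm (Z \<omega>))\<^sup>2)"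
  shows "integrable M Z"
proof (rule Bochner_Integration.integrable_bound)
  interpret finite_measure M by fact
  show "integrable M (\<lambda>\<omega>. 1 + (norm (Z \<omega>))\<^sup>2)" using assms(3) by simp
  have "a \<le> 1 + a\<^sup>2" for a :: real
  proof -
    have "2 * a \<le> 1 + a\<^sup>2" using zero_le_power2[of "a - 1"] by (simp add: power2_diff)
    thus ?thesis using zero_le_power2[of a] by linarith
  qed
  thus "AE \<omega> in M. norm (Z \<omega>) \<le> norm (1 + (norm (Z \<omega>))\<^sup>2)" by simp
qed (use assms in auto)

lemma integrable_inner_of_squares:
  fixes Z1 Z2 :: "'p \<Rightarrow> 'h::{real_inner,banach,second_countable_topology}"
  assumes [measurable]: "Z1 \<in> borel_measurable M" "Z2 \<in> borel_measurable M"
    and "integrable M (\<lambda>\<omega>. (norm (Z1 \<omega>))\<^sup>2)" "integrable M (\<lambda>\<omega>. (norm (Z2 \<omega>))\<^sup>2)"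
  shows "integrable M (\<lambda>\<omega>. Z1 \<omega> \<bullet> Z2 \<omega>)"
proof (rule Bochner_Integration.integrable_bound)
  show "integrable M (\<lambda>\<omega>. (norm (Z1 \<omega>))\<^sup>2 + (norm (Z2 \<omega>))\<^sup>2)" using assms by simp
  have "\<bar>a \<bullet> b\<bar> \<le> (norm a)\<^sup>2 + (norm b)\<^sup>2" for a b :: 'h
  proof -
    have "2 * (norm a * norm b) \<le> (norm a)\<^sup>2 + (norm b)\<^sup>2"
      using zero_le_power2[of "norm a - norm b"] by (simp add: power2_diff)
    thus ?thesis using Cauchy_Schwarz_ineq2[of a b]
      mult_nonneg_nonneg[OF norm_ge_zero[of a] norm_ge_zero[of b]] by linarith
  qed
  thus "AE \<omega> in M. norm (Z1 \<omega> \<bullet> Z2 \<omega>) \<le> norm ((norm (Z1 \<omega>))\<^sup>2 + (norm (Z2 \<omega>))\<^sup>2)" by simp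
qed simp

lemma (in prob_space) indep_vars_imp_indep_var:
  assumes "indep_vars (\<lambda>_. N) Z I" "i \<in> I" "j \<in> I" "i \<noteq> j"
  shows "indep_var N (Z i) N (Z j)"
proof -
  have "indep_var N ((\<lambda>f. f i) \<circ> (\<lambda>\<omega>. restrict (\<lambda>k. Z k \<omega>) {i}))
      N ((\<lambda>f. f j) \<circ> (\<lambda>\<omega>. restrict (\<lambda>k. Z k \<omega>) {j}))"
    by (rule indep_var_compose[OF indep_var_restrict[OF assms(1), of "{i}" "{j}"]])
      (use assms in auto)
  thus ?thesis by (simp add: comp_def)
qed

text \<open>
  The variables are independent and centred, so the mixed terms of the squared norm vanish in expectation.  The
  function \<open>f\<close> is applied to the whole observation; it will be the noise vector \<open>(y - \<beta> \<bullet> x) x\<close> and, for each \<open>j\<close>, the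
  error vector \<open>(x \<otimes> x - K) v\<^sub>j\<close>.
\<close>

lemma iid_mean_second_moment:
  fixes f :: "'c::topological_space \<Rightarrow> 'h::{real_inner,banach,second_countable_topology}"
  assumes M: "prob_space M" and P: "prob_space P"
    and ind: "prob_space.indep_vars M (\<lambda>_. borel) W {1..n}"
    and copies: "\<And>i. i \<in> {1..n} \<Longrightarrow> distr M borel (W i) = distr P borel V"
    and V[measurable]: "V \<in> borel_measurable P" and f[measurable]: "f \<in> borel_measurable borel"
    and sq: "integrable P (\<lambda>\<omega>. (norm (f (V \<omega>)))\<^sup>2)" and mean: "(\<integral>\<omega>. f (V \<omega>) \<partial>P) = 0"
    and n: "1 \<le> n"
  shows "integrable M (\<lambda>\<omega>. (norm ((1 / real n) *\<^sub>R (\<Sum>i=1..n. f (W i \<omega>))))\<^sup>2)" (is ?int)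
    and "(\<integral>\<omega>. (norm ((1 / real n) *\<^sub>R (\<Sum>i=1..n. f (W i \<omega>))))\<^sup>2 \<partial>M)
      = (\<integral>\<omega>. (norm (f (V \<omega>)))\<^sup>2 \<partial>P) / real n" (is ?eq)
proof -
  interpret M: prob_space M by fact
  interpret P: prob_space P by fact
  define Z where "Z i \<omega> = f (W i \<omega>)" for i \<omega>
  have W: "W i \<in> borel_measurable M" if "i \<in> {1..n}" for i
    using ind that by (auto simp: M.indep_vars_def2)
  have Zm[measurable]: "Z i \<in> borel_measurable M" if "i \<in> {1..n}" for i
    unfolding Z_def using measurable_compose[OF W[OF that] f] .
  have transfer: "integrable M (\<lambda>\<omega>. g (W i \<omega>)) = integrable P (\<lambda>\<omega>. g (V \<omega>))"
    "(\<integral>\<omega>. g (W i \<omega>) \<partial>M) = (\<integral>\<omega>. g (V \<omega>) \<partial>P)"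
    if "i \<in> {1..n}" "g \<in> borel_measurable borel" for i and g :: "'c \<Rightarrow> 'z::{banach,second_countable_topology}"
  proof -
    show "integrable M (\<lambda>\<omega>. g (W i \<omega>)) = integrable P (\<lambda>\<omega>. g (V \<omega>))"
      using integrable_distr_eq[OF W[OF that(1)] that(2)] integrable_distr_eq[OF V that(2)] copies[OF that(1)]
      by simp
    show "(\<integral>\<omega>. g (W i \<omega>) \<partial>M) = (\<integral>\<omega>. g (V \<omega>) \<partial>P)"
      using integral_distr[OF W[OF that(1)] that(2)] integral_distr[OF V that(2)] copies[OF that(1)]
      by simp
  qed
  have Zsq: "integrable M (\<lambda>\<omega>. (norm (Z i \<omega>))\<^sup>2)" "(\<integral>\<omega>. (norm (Z i \<omega>))\<^sup>2 \<partial>M) = (\<integral>\<omega>. (norm (f (V \<omega>)))\<^sup>2 \<partial>P)"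
    if "i \<in> {1..n}" for i
    unfolding Z_def using transfer[OF that, of "\<lambda>c. (norm (f c))\<^sup>2"] sq by auto
  have Zi: "integrable M (Z i)" if "i \<in> {1..n}" for i
    by (rule integrable_of_square_integrable) (use Zm Zsq that M.finite_measure_axioms in auto)
  have Z0: "(\<integral>\<omega>. Z i \<omega> \<partial>M) = 0" if "i \<in> {1..n}" for i
    unfolding Z_def using transfer(2)[OF that f] mean by simp
  have Zin: "integrable M (\<lambda>\<omega>. Z i \<omega> \<bullet> Z j \<omega>)" if "i \<in> {1..n}" "j \<in> {1..n}" for i j
    by (rule integrable_inner_of_squares) (use Zm Zsq that in auto)
  have indZ: "M.indep_vars (\<lambda>_. borel) Z {1..n}"
    unfolding Z_def using M.indep_vars_compose2[OF ind, of "\<lambda>_. f" "\<lambda>_. borel"] by simp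
  have cross: "(\<integral>\<omega>. Z i \<omega> \<bullet> Z j \<omega> \<partial>M) = 0" if "i \<in> {1..n}" "j \<in> {1..n}" "i \<noteq> j" for i j
    using M.indep_inner_expectation[OF M.indep_vars_imp_indep_var[OF indZ that] Zi[OF that(1)] Zi[OF that(2)] Zin[OF that(1,2)]]
      Z0[OF that(1)] by simp
  have expand: "(norm ((1 / real n) *\<^sub>R (\<Sum>i=1..n. f (W i \<omega>))))\<^sup>2
      = (1 / (real n)\<^sup>2) * (\<Sum>i=1..n. \<Sum>j=1..n. Z i \<omega> \<bullet> Z j \<omega>)" for \<omega>
  proof -
    have "(norm (\<Sum>i=1..n. Z i \<omega>))\<^sup>2 = (\<Sum>i=1..n. \<Sum>j=1..n. Z i \<omega> \<bullet> Z j \<omega>)"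
      unfolding power2_norm_eq_inner by (subst inner_sum_left, intro sum.cong refl, rule inner_sum_right)
    thus ?thesis by (simp add: Z_def power_divide)
  qed
  show ?int unfolding expand using Zin by (intro integrable_mult_right Bochner_Integration.integrable_sum) auto
  have "(\<integral>\<omega>. (norm ((1 / real n) *\<^sub>R (\<Sum>i=1..n. f (W i \<omega>))))\<^sup>2 \<partial>M)
      = (1 / (real n)\<^sup>2) * (\<Sum>i=1..n. \<Sum>j=1..n. (\<integral>\<omega>. Z i \<omega> \<bullet> Z j \<omega> \<partial>M))"
  proof -
    have "(\<integral>\<omega>. (\<Sum>i=1..n. \<Sum>j=1..n. Z i \<omega> \<bullet> Z j \<omega>) \<partial>M) = (\<Sum>i=1..n. (\<integral>\<omega>. (\<Sum>j=1..n. Z i \<omega> \<bullet> Z j \<omega>) \<partial>M))"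
      using Zin by (intro Bochner_Integration.integral_sum Bochner_Integration.integrable_sum)
    also have "\<dots> = (\<Sum>i=1..n. \<Sum>j=1..n. (\<integral>\<omega>. Z i \<omega> \<bullet> Z j \<omega> \<partial>M))"
      using Zin by (intro sum.cong refl Bochner_Integration.integral_sum)
    finally show ?thesis unfolding expand by (subst integral_mult_right_zero) simp
  qed
  also have "(\<Sum>i=1..n. \<Sum>j=1..n. (\<integral>\<omega>. Z i \<omega> \<bullet> Z j \<omega> \<partial>M))
      = (\<Sum>i=1..n. \<Sum>j=1..n. if i = j then (\<integral>\<omega>. (norm (f (V \<omega>)))\<^sup>2 \<partial>P) else 0)"
  proof (intro sum.cong refl)
    fix i j assume ij: "i \<in> {1..n}" "j \<in> {1..n}"
    show "(\<integral>\<omega>. Z i \<omega> \<bullet> Z j \<omega> \<partial>M) = (if i = j then (\<integral>\<omega>. (norm (f (V \<omega>)))\<^sup>2 \<partial>P) else 0)"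
      using cross[OF ij] Zsq(2)[OF ij(1)] by (auto simp: power2_norm_eq_inner)
  qed
  also have "\<dots> = real n * (\<integral>\<omega>. (norm (f (V \<omega>)))\<^sup>2 \<partial>P)" by simp
  finally show ?eq using n by (simp add: power2_eq_square)
qed

lemma centered_second_moment_le:
  fixes Z :: "'p \<Rightarrow> 'h::{real_inner,banach,second_countable_topology}"
  assumes "prob_space P" and [measurable]: "Z \<in> borel_measurable P"
    and sq: "integrable P (\<lambda>\<omega>. (norm (Z \<omega>))\<^sup>2)" and m: "(\<integral>\<omega>. Z \<omega> \<partial>P) = m"
  shows "integrable P (\<lambda>\<omega>. (norm (Z \<omega> - m))\<^sup>2)"
    and "(\<integral>\<omega>. Z \<omega> - m \<partial>P) = 0"
    and "(\<integral>\<omega>. (norm (Z \<omega> - m))\<^sup>2 \<partial>P) \<le> (\<integral>\<omega>. (norm (Z \<omega>))\<^sup>2 \<partial>P)"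
proof -
  interpret prob_space P by fact
  have Zi: "integrable P Z"
    by (rule integrable_of_square_integrable) (use sq finite_measure_axioms in auto)
  have expand: "(norm (Z \<omega> - m))\<^sup>2 = (norm (Z \<omega>))\<^sup>2 - 2 * (Z \<omega> \<bullet> m) + (norm m)\<^sup>2" for \<omega>
    by (simp add: power2_norm_eq_inner inner_diff_left inner_diff_right inner_commute)
  show "integrable P (\<lambda>\<omega>. (norm (Z \<omega> - m))\<^sup>2)" unfolding expand using sq Zi by simp
  show "(\<integral>\<omega>. Z \<omega> - m \<partial>P) = 0" using Zi m by (simp add: prob_space)
  have "(\<integral>\<omega>. (norm (Z \<omega> - m))\<^sup>2 \<partial>P) = (\<integral>\<omega>. (norm (Z \<omega>))\<^sup>2 \<partial>P) - (norm m)\<^sup>2"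
    unfolding expand using sq Zi m by (simp add: prob_space power2_norm_eq_inner)
  thus "(\<integral>\<omega>. (norm (Z \<omega> - m))\<^sup>2 \<partial>P) \<le> (\<integral>\<omega>. (norm (Z \<omega>))\<^sup>2 \<partial>P)" by simp
qed

text \<open>
  As \<open>\<parallel>X\<parallel>\<^sup>2\<close> is measurable with respect to \<open>X\<close>, the factor \<open>eps\<^sup>2\<close> may be replaced by its conditional expectation
  given \<open>X\<close>.
\<close>

lemma conditional_variance_moment_bound:
  fixes X :: "'p \<Rightarrow> 'h::{real_inner,banach,second_countable_topology}"
  assumes "prob_space P" and X[measurable]: "X \<in> borel_measurable P" and eps[measurable]: "eps \<in> borel_measurable P"
    and sq: "integrable P (\<lambda>\<omega>. (norm (X \<omega>))\<^sup>2)"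
    and cond_var: "AE \<omega> in P. nn_cond_exp P (vimage_algebra (space P) X borel)
                      (\<lambda>\<omega>. ennreal ((eps \<omega>)\<^sup>2)) \<omega> \<le> ennreal (\<sigma>\<^sup>2)"
  shows "integrable P (\<lambda>\<omega>. (norm (eps \<omega> *\<^sub>R X \<omega>))\<^sup>2)"
    and "(\<integral>\<omega>. (norm (eps \<omega> *\<^sub>R X \<omega>))\<^sup>2 \<partial>P) \<le> \<sigma>\<^sup>2 * (\<integral>\<omega>. (norm (X \<omega>))\<^sup>2 \<partial>P)"
proof -
  interpret prob_space P by fact
  let ?F = "vimage_algebra (space P) X borel"
  have sub: "subalgebra P ?F"
    unfolding subalgebra_def using X by (auto simp: sets_vimage_algebra2 measurable_sets)
  interpret finite_measure_subalgebra P ?F by unfold_locales (rule sub)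
  have XF: "X \<in> borel_measurable ?F" by (rule measurable_vimage_algebra1) auto
  have fF: "(\<lambda>\<omega>. ennreal ((norm (X \<omega>))\<^sup>2)) \<in> borel_measurable ?F"
    using XF by measurable
  have "(\<integral>\<^sup>+\<omega>. ennreal ((norm (eps \<omega> *\<^sub>R X \<omega>))\<^sup>2) \<partial>P)
      = (\<integral>\<^sup>+\<omega>. ennreal ((norm (X \<omega>))\<^sup>2) * ennreal ((eps \<omega>)\<^sup>2) \<partial>P)"
    by (intro nn_integral_cong) (simp add: power_mult_distrib ennreal_mult[symmetric] mult.commute)
  also have "\<dots> = (\<integral>\<^sup>+\<omega>. ennreal ((norm (X \<omega>))\<^sup>2) * nn_cond_exp P ?F (\<lambda>\<omega>. ennreal ((eps \<omega>)\<^sup>2)) \<omega> \<partial>P)"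
    by (rule nn_cond_exp_intg[symmetric, OF fF]) simp
  also have "\<dots> \<le> (\<integral>\<^sup>+\<omega>. ennreal ((norm (X \<omega>))\<^sup>2) * ennreal (\<sigma>\<^sup>2) \<partial>P)"
    by (rule nn_integral_mono_AE) (use cond_var in \<open>auto elim!: eventually_mono intro!: mult_left_mono\<close>)
  also have "\<dots> = (\<integral>\<^sup>+\<omega>. ennreal (\<sigma>\<^sup>2 * (norm (X \<omega>))\<^sup>2) \<partial>P)"
    by (intro nn_integral_cong) (simp add: ennreal_mult[symmetric] mult.commute)
  also have "\<dots> = ennreal (\<sigma>\<^sup>2 * (\<integral>\<omega>. (norm (X \<omega>))\<^sup>2 \<partial>P))"
    using sq by (subst nn_integral_eq_integral) auto
  finally have le: "(\<integral>\<^sup>+\<omega>. ennreal ((norm (eps \<omega> *\<^sub>R X \<omega>))\<^sup>2) \<partial>P) \<le> ennreal (\<sigma>\<^sup>2 * (\<integral>\<omega>. (norm (X \<omega>))\<^sup>2 \<partial>P))" .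
  show int: "integrable P (\<lambda>\<omega>. (norm (eps \<omega> *\<^sub>R X \<omega>))\<^sup>2)"
  proof (rule integrableI_bounded)
    have "(\<integral>\<^sup>+\<omega>. ennreal (norm ((norm (eps \<omega> *\<^sub>R X \<omega>))\<^sup>2)) \<partial>P) \<le> ennreal (\<sigma>\<^sup>2 * (\<integral>\<omega>. (norm (X \<omega>))\<^sup>2 \<partial>P))"
      using le by simp
    also have "\<dots> < \<infinity>" by simp
    finally show "(\<integral>\<^sup>+\<omega>. ennreal (norm ((norm (eps \<omega> *\<^sub>R X \<omega>))\<^sup>2)) \<partial>P) < \<infinity>" .
  qed simp
  show "(\<integral>\<omega>. (norm (eps \<omega> *\<^sub>R X \<omega>))\<^sup>2 \<partial>P) \<le> \<sigma>\<^sup>2 * (\<integral>\<omega>. (norm (X \<omega>))\<^sup>2 \<partial>P)"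
    using le int by (subst (asm) nn_integral_eq_integral) auto
qed

lemma markov_exceedance:
  assumes "prob_space M" "integrable M u" "\<And>\<omega>. 0 \<le> u \<omega>" "0 < c" "(\<integral>\<omega>. u \<omega> \<partial>M) \<le> c * p"
  shows "measure M {\<omega> \<in> space M. c < u \<omega>} \<le> p"
proof -
  interpret prob_space M by fact
  have [measurable]: "u \<in> borel_measurable M" using assms(2) by simp
  have "measure M {\<omega> \<in> space M. c < u \<omega>} \<le> measure M {\<omega> \<in> space M. c \<le> u \<omega>}"
    by (intro finite_measure_mono) auto
  also have "\<dots> \<le> (\<integral>\<omega>. u \<omega> \<partial>M) / c"
    by (rule integral_Markov_inequality_measure[OF assms(2), of "{}"]) (use assms in auto)
  also have "\<dots> \<le> p" using assms(4,5) by (simp add: pos_divide_le_eq mult.commute)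
  finally show ?thesis .
qed

section \<open>Measurability of the stopping index\<close>

text \<open>
  The family \<open>f\<close> need not be injective: powers of \<open>T\<close> applied to \<open>r\<close> may coincide.
\<close>

lemma span_image_coefficients:
  fixes f :: "'i \<Rightarrow> 'a::real_vector"
  assumes "finite A" "z \<in> span (f ` A)"
  obtains c where "z = (\<Sum>i\<in>A. c i *\<^sub>R f i)"
proof -
  have "subspace (range (\<lambda>c. \<Sum>i\<in>A. c i *\<^sub>R f i))"
  proof (rule subspaceI)
    show "0 \<in> range (\<lambda>c. \<Sum>i\<in>A. c i *\<^sub>R f i)" by (rule range_eqI[of _ _ "\<lambda>_. 0"]) simp
    fix x y assume "x \<in> range (\<lambda>c. \<Sum>i\<in>A. c i *\<^sub>R f i)" "y \<in> range (\<lambda>c. \<Sum>i\<in>A. c i *\<^sub>R f i)"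
    then obtain c d where "x = (\<Sum>i\<in>A. c i *\<^sub>R f i)" "y = (\<Sum>i\<in>A. d i *\<^sub>R f i)" by auto
    thus "x + y \<in> range (\<lambda>c. \<Sum>i\<in>A. c i *\<^sub>R f i)"
      by (intro range_eqI[of _ _ "\<lambda>i. c i + d i"]) (simp add: scaleR_add_left sum.distrib)
  next
    fix r x assume "x \<in> range (\<lambda>c. \<Sum>i\<in>A. c i *\<^sub>R f i)"
    then obtain c where "x = (\<Sum>i\<in>A. c i *\<^sub>R f i)" by auto
    thus "r *\<^sub>R x \<in> range (\<lambda>c. \<Sum>i\<in>A. c i *\<^sub>R f i)"
      by (intro range_eqI[of _ _ "\<lambda>i. r * c i"]) (simp add: scaleR_sum_right)
  qed
  moreover have "f ` A \<subseteq> range (\<lambda>c. \<Sum>i\<in>A. c i *\<^sub>R f i)"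
  proof
    fix x assume "x \<in> f ` A"
    then obtain i where i: "i \<in> A" "x = f i" by auto
    have "(\<Sum>j\<in>A. (if j = i then 1 else 0) *\<^sub>R f j) = (\<Sum>j\<in>A. if j = i then f j else 0)"
      by (intro sum.cong) auto
    also have "\<dots> = f i" using i assms(1) by simp
    finally show "x \<in> range (\<lambda>c. \<Sum>i\<in>A. c i *\<^sub>R f i)"
      using i by (intro range_eqI[of _ _ "\<lambda>j. if j = i then 1 else 0"]) simp
  qed
  ultimately have "span (f ` A) \<subseteq> range (\<lambda>c. \<Sum>i\<in>A. c i *\<^sub>R f i)" by (rule span_minimal[rotated])
  thus ?thesis using assms(2) that by auto
qed

text \<open>
  The residual is an infimum over all coefficient vectors, and by continuity rational ones suffice.  This exhibits
  \<open>{residual \<le> t}\<close> by countably many operations on measurable functions, without a measurable selection of the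
  minimiser.
\<close>

lemma pls_residual_le_iff:
  "norm (emp_r n x y - emp_K n x (pls n x y m)) \<le> t \<longleftrightarrow>
   (\<forall>k::nat. \<exists>q::rat list.
      norm (emp_r n x y - (\<Sum>i<m. real_of_rat (q ! i) *\<^sub>R (emp_K n x ^^ Suc i) (emp_r n x y))) < t + inverse (real (Suc k)))"
    (is "?L \<longleftrightarrow> ?R")
proof
  let ?r = "emp_r n x y" and ?T = "emp_K n x"
  interpret T: bounded_linear ?T by (rule bounded_linear_emp_K)
  {
    assume L: ?L
    obtain c where c: "pls n x y m = (\<Sum>i<m. c i *\<^sub>R (?T ^^ i) ?r)"
      using span_image_coefficients[OF finite_lessThan pls_in_krylov[of n x y m, unfolded krylov_eq]] .
    have Tp: "?T (pls n x y m) = (\<Sum>i<m. c i *\<^sub>R (?T ^^ Suc i) ?r)"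
      unfolding c by (simp add: T.sum T.scaleR)
    show ?R
    proof
      fix k :: nat
      define S where "S = (\<Sum>i<m. norm ((?T ^^ Suc i) ?r))"
      have S: "0 \<le> S" by (simp add: S_def sum_nonneg)
      \<comment> \<open>the accuracy of the coefficients; the \<open>+ 1\<close> covers \<open>S = 0\<close>\<close>
      define e where "e = inverse (real (Suc k)) / (S + 1)"
      have e: "0 < e" using S by (simp add: e_def)
      have "\<exists>q. c i - e < real_of_rat q \<and> real_of_rat q < c i + e" for i
        using of_rat_dense[of "c i - e" "c i + e"] e by auto
      then obtain g where g: "\<And>i. c i - e < real_of_rat (g i) \<and> real_of_rat (g i) < c i + e" by metis
      define q where "q = map g [0..<m]"
      have q: "\<bar>c i - real_of_rat (q ! i)\<bar> \<le> e" if "i < m" for i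
        using g[of i] that by (auto simp: q_def abs_le_iff)
      have "?r - (\<Sum>i<m. real_of_rat (q ! i) *\<^sub>R (?T ^^ Suc i) ?r)
          = (?r - ?T (pls n x y m)) + (\<Sum>i<m. (c i - real_of_rat (q ! i)) *\<^sub>R (?T ^^ Suc i) ?r)"
        unfolding Tp by (simp add: scaleR_diff_left sum_subtractf)
      hence "norm (?r - (\<Sum>i<m. real_of_rat (q ! i) *\<^sub>R (?T ^^ Suc i) ?r))
          \<le> norm (?r - ?T (pls n x y m)) + norm (\<Sum>i<m. (c i - real_of_rat (q ! i)) *\<^sub>R (?T ^^ Suc i) ?r)"
        by (simp only: norm_triangle_ineq)
      also have "norm (?r - ?T (pls n x y m)) \<le> t" by (rule L)
      also have "norm (\<Sum>i<m. (c i - real_of_rat (q ! i)) *\<^sub>R (?T ^^ Suc i) ?r) \<le> e * S"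
        unfolding S_def sum_distrib_left
        by (intro sum_norm_le) (use q in \<open>auto intro!: mult_right_mono\<close>)
      also have "e * S < inverse (real (Suc k))"
      proof -
        have "e * S < e * (S + 1)" using e by simp
        also have "\<dots> = inverse (real (Suc k))" using S by (simp add: e_def)
        finally show ?thesis .
      qed
      finally show "\<exists>q::rat list. norm (?r - (\<Sum>i<m. real_of_rat (q ! i) *\<^sub>R (?T ^^ Suc i) ?r)) < t + inverse (real (Suc k))"
        by (intro exI[of _ q]) simp
    qed
  next
    assume R: ?R
    show ?L
    proof (rule field_le_epsilon)
      fix e :: real assume "0 < e"
      then obtain k where k: "inverse (real (Suc k)) < e" using reals_Archimedean by auto
      obtain q :: "rat list" where q: "norm (?r - (\<Sum>i<m. real_of_rat (q ! i) *\<^sub>R (?T ^^ Suc i) ?r)) < t + inverse (real (Suc k))"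
        using R by blast
      define b where "b = (\<Sum>i<m. real_of_rat (q ! i) *\<^sub>R (?T ^^ i) ?r)"
      have "b \<in> krylov n x y m"
        unfolding b_def krylov_eq by (intro span_sum span_scale span_base) auto
      moreover have "?T b = (\<Sum>i<m. real_of_rat (q ! i) *\<^sub>R (?T ^^ Suc i) ?r)"
        unfolding b_def by (simp add: T.sum T.scaleR)
      ultimately show "norm (?r - ?T (pls n x y m)) \<le> t + e"
        using residual_pls_le[of b n x y m] q k by simp
    qed
  }
qed

lemma measurable_emp_K:
  fixes x :: "nat \<Rightarrow> 'b \<Rightarrow> 'a::{real_inner,banach,second_countable_topology}"
  assumes "\<And>i. i \<in> {1..n} \<Longrightarrow> x i \<in> borel_measurable M" "W \<in> borel_measurable M"
  shows "(\<lambda>\<omega>. emp_K n (\<lambda>i. x i \<omega>) (W \<omega>)) \<in> borel_measurable M"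
  unfolding emp_K_def rank_one_def
  by (intro borel_measurable_scaleR borel_measurable_sum borel_measurable_inner borel_measurable_const assms)

lemma measurable_emp_r:
  fixes x :: "nat \<Rightarrow> 'b \<Rightarrow> 'a::{real_inner,banach,second_countable_topology}"
  assumes "\<And>i. i \<in> {1..n} \<Longrightarrow> x i \<in> borel_measurable M" "\<And>i. i \<in> {1..n} \<Longrightarrow> y i \<in> borel_measurable M"
  shows "(\<lambda>\<omega>. emp_r n (\<lambda>i. x i \<omega>) (\<lambda>i. y i \<omega>)) \<in> borel_measurable M"
  unfolding emp_r_def
  by (intro borel_measurable_scaleR borel_measurable_sum borel_measurable_const assms)

lemma measurable_pls_stop:
  fixes x :: "nat \<Rightarrow> 'b \<Rightarrow> 'a::{real_inner,banach,second_countable_topology}"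
  assumes x: "\<And>i. i \<in> {1..n} \<Longrightarrow> x i \<in> borel_measurable M" and y: "\<And>i. i \<in> {1..n} \<Longrightarrow> y i \<in> borel_measurable M"
  shows "(\<lambda>\<omega>. pls_stop n (\<lambda>i. x i \<omega>) (\<lambda>i. y i \<omega>) t) \<in> measurable M (count_space UNIV)"
proof -
  have [measurable]: "(\<lambda>\<omega>. emp_r n (\<lambda>i. x i \<omega>) (\<lambda>i. y i \<omega>)) \<in> borel_measurable M"
    by (rule measurable_emp_r[OF x y])
  have [measurable]: "(\<lambda>\<omega>. (emp_K n (\<lambda>i. x i \<omega>) ^^ k) (emp_r n (\<lambda>i. x i \<omega>) (\<lambda>i. y i \<omega>))) \<in> borel_measurable M" for k
  proof (induction k)
    case (Suc k)
    show ?case using measurable_emp_K[OF x Suc] by simp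
  qed simp
  show ?thesis
    unfolding pls_stop_def pls_residual_le_iff by measurable
qed

section \<open>The good event and the theorem\<close>

text \<open>
  By Bessel's inequality the expansion of \<open>b\<close> in the \<open>v j\<close> converges to some \<open>s\<close>.  The difference \<open>b - s\<close> is orthogonal to
  all \<open>v j\<close>, so \<open>T\<close> maps it to \<open>0\<close>, and injectivity of \<open>T\<close> gives \<open>b = s\<close>.  Injectivity also excludes vanishing \<open>lam j\<close>.
\<close>

lemma spectral_decomp_eigenbasis:
  fixes T :: "'a::{real_inner,banach} \<Rightarrow> 'a"
  assumes sd: "spectral_decomp T J lam v" and nz: "\<not> is_eigenvalue T 0"
  shows "eigenbasis J lam v" and "\<And>j. j \<in> J \<Longrightarrow> T (v j) = lam j *\<^sub>R v j"
proof -
  have J: "J = {1..} \<or> (\<exists>N. J = {1..N})"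
    and orth: "\<And>i j. i \<in> J \<Longrightarrow> j \<in> J \<Longrightarrow> v i \<bullet> v j = (if i = j then 1 else 0)"
    and nn: "\<And>j. j \<in> J \<Longrightarrow> 0 \<le> lam j"
    and sum: "\<And>b. ((\<lambda>j. lam j *\<^sub>R rank_one (v j) b) has_sum T b) J"
    using sd unfolding spectral_decomp_def by blast+
  show ev: "T (v j) = lam j *\<^sub>R v j" if "j \<in> J" for j
  proof -
    have "((\<lambda>i. lam i *\<^sub>R rank_one (v i) (v j)) has_sum (\<Sum>i\<in>{j}. lam i *\<^sub>R rank_one (v i) (v j))) {j}"
      by (rule has_sum_finite) simp
    hence "((\<lambda>i. lam i *\<^sub>R rank_one (v i) (v j)) has_sum (lam j *\<^sub>R v j)) {j}"
      using orth[OF that that] by (simp add: rank_one_def)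
    hence "((\<lambda>i. lam i *\<^sub>R rank_one (v i) (v j)) has_sum (lam j *\<^sub>R v j)) J"
      by (subst (asm) has_sum_cong_neutral[where T = J and g = "\<lambda>i. lam i *\<^sub>R rank_one (v i) (v j)"])
        (use that orth in \<open>auto simp: rank_one_def\<close>)
    thus ?thesis using sum[of "v j"] by (metis has_sum_unique)
  qed
  have lam_pos: "0 < lam j" if "j \<in> J" for j
  proof (rule ccontr)
    assume "\<not> 0 < lam j"
    hence "T (v j) = 0 *\<^sub>R v j" using ev[OF that] nn[OF that] by simp
    moreover have "v j \<noteq> 0" using orth[OF that that] by auto
    ultimately show False using nz by (auto simp: is_eigenvalue_def)
  qed
  have expand: "(\<lambda>N. \<Sum>j\<in>J \<inter> {..N}. (v j \<bullet> b) *\<^sub>R v j) \<longlonglongrightarrow> b" for b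
  proof -
    define S where "S N = (\<Sum>j\<in>J \<inter> {..N}. (v j \<bullet> b) *\<^sub>R v j)" for N :: nat
    define a where "a N = (\<Sum>j\<in>J \<inter> {..N}. (v j \<bullet> b)\<^sup>2)" for N :: nat
    have "incseq a" unfolding a_def incseq_def by (auto intro!: sum_mono2)
    moreover have "a N \<le> (norm b)\<^sup>2" for N
      unfolding a_def by (rule bessel) (use orth in auto)
    ultimately have "convergent a"
      by (metis incseq_convergent convergent_def)
    hence "Cauchy a" by (rule convergent_Cauchy)
    have gap: "(norm (S N - S K))\<^sup>2 = a N - a K" if "K \<le> N" for N K
    proof -
      have s: "J \<inter> {..N} = (J \<inter> {..K}) \<union> (J \<inter> {K<..N})" using that by auto
      have d: "sum h (J \<inter> {..N}) = sum h (J \<inter> {..K}) + sum h (J \<inter> {K<..N})"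
        for h :: "nat \<Rightarrow> 'z::comm_monoid_add"
        unfolding s by (rule sum.union_disjoint) auto
      have "S N - S K = (\<Sum>j\<in>J \<inter> {K<..N}. (v j \<bullet> b) *\<^sub>R v j)" by (simp add: S_def d)
      moreover have "a N - a K = (\<Sum>j\<in>J \<inter> {K<..N}. (v j \<bullet> b)\<^sup>2)" by (simp add: a_def d)
      ultimately show ?thesis using norm_sum_orthonormal[of "J \<inter> {K<..N}" v "\<lambda>j. v j \<bullet> b"] orth by auto
    qed
    have gap': "(norm (S N - S K))\<^sup>2 = \<bar>a N - a K\<bar>" for N K
    proof -
      have abs_gap: "(norm (S N - S K))\<^sup>2 = \<bar>a N - a K\<bar>" if "K \<le> N" for N K
        using gap[OF that] zero_le_power2[of "norm (S N - S K)"] by simp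
      show ?thesis
        using abs_gap[of K N] abs_gap[of N K] norm_minus_commute[of "S N" "S K"] abs_minus_commute[of "a N" "a K"]
        by (cases "K \<le> N") auto
    qed
    have "Cauchy S"
    proof (rule CauchyI)
      fix e :: real assume "0 < e"
      hence "0 < e\<^sup>2" by simp
      then obtain K where K: "\<And>m n. m \<ge> K \<Longrightarrow> n \<ge> K \<Longrightarrow> norm (a m - a n) < e\<^sup>2"
        using CauchyD[OF \<open>Cauchy a\<close>] by metis
      have "norm (S m - S n) < e" if "m \<ge> K" "n \<ge> K" for m n
        using K[OF that] gap'[of m n] \<open>0 < e\<close> by (metis real_norm_def power_less_imp_less_base less_imp_le)
      thus "\<exists>M. \<forall>m\<ge>M. \<forall>n\<ge>M. norm (S m - S n) < e" by blast
    qed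
    then obtain s where s: "S \<longlonglongrightarrow> s" using Cauchy_convergent convergent_def by blast
    have "v i \<bullet> (b - s) = 0" if "i \<in> J" for i
    proof -
      have "v i \<bullet> S N = v i \<bullet> b" if "i \<le> N" for N
      proof -
        have "v i \<bullet> S N = (\<Sum>j\<in>J \<inter> {..N}. if j = i then v i \<bullet> b else 0)"
          unfolding S_def inner_sum_right inner_scaleR_right
          using orth \<open>i \<in> J\<close> by (intro sum.cong) auto
        thus ?thesis using that \<open>i \<in> J\<close> by simp
      qed
      hence "(\<lambda>N. v i \<bullet> S N) \<longlonglongrightarrow> v i \<bullet> b"
        by (intro tendsto_eventually eventually_sequentiallyI[of i])
      moreover have "(\<lambda>N. v i \<bullet> S N) \<longlonglongrightarrow> v i \<bullet> s" by (intro tendsto_intros s)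
      ultimately have "v i \<bullet> b = v i \<bullet> s" by (rule LIMSEQ_unique)
      thus ?thesis by (simp add: inner_diff_right)
    qed
    hence "((\<lambda>j. lam j *\<^sub>R rank_one (v j) (b - s)) has_sum 0) J"
      by (intro has_sum_0) (auto simp: rank_one_def)
    hence "T (b - s) = 0 *\<^sub>R (b - s)" using sum[of "b - s"] by (metis has_sum_unique scaleR_zero_left)
    hence "b = s" using nz unfolding is_eigenvalue_def by (metis eq_iff_diff_eq_0)
    thus ?thesis using s unfolding S_def by simp
  qed
  show "eigenbasis J lam v"
    by unfold_locales (use J orth lam_pos expand in auto)
qed
text \<open>
  Each of the two error bounds fails with probability at most \<open>\<delta>/2\<close>.  For the covariance error, the fixed orthonormal
  system \<open>v\<close> turns the Hilbert--Schmidt norm into a sum of squared norms of means, whose expectations add up to at most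
  \<open>E \<parallel>X\<parallel>\<^sup>4 / n\<close> by Bessel's inequality; the infinite sum is reached by monotone convergence of the exceedance events.
\<close>

lemma close_data_event:
  fixes X :: "'p \<Rightarrow> 'a::{real_inner,banach,second_countable_topology}" and Xs :: "nat \<Rightarrow> 'b \<Rightarrow> 'a"
  assumes eb: "eigenbasis J lam v" and P: "prob_space P" and M: "prob_space M"
    and X[measurable]: "X \<in> borel_measurable P" and eps[measurable]: "eps \<in> borel_measurable P"
    and Y: "\<And>\<omega>. \<omega> \<in> space P \<Longrightarrow> Y \<omega> = \<beta> \<bullet> X \<omega> + eps \<omega>"
    and eps_X: "(\<integral>\<omega>. eps \<omega> *\<^sub>R X \<omega> \<partial>P) = 0"
    and moment_X: "integrable P (\<lambda>\<omega>. norm (X \<omega>) ^ 4)"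
    and sq: "integrable P (\<lambda>\<omega>. (norm (X \<omega>))\<^sup>2)"
    and sigma: "0 < \<sigma>"
    and cond_var: "AE \<omega> in P. nn_cond_exp P (vimage_algebra (space P) X borel)
                      (\<lambda>\<omega>. ennreal ((eps \<omega>)\<^sup>2)) \<omega> \<le> ennreal (\<sigma>\<^sup>2)"
    and cov: "\<And>j. j \<in> J \<Longrightarrow> cov_op P X (v j) = lam j *\<^sub>R v j"
    and pos2: "0 < (\<integral>\<omega>. (norm (X \<omega>))\<^sup>2 \<partial>P)" and pos4: "0 < (\<integral>\<omega>. norm (X \<omega>) ^ 4 \<partial>P)"
    and iid: "iid_copies M n Xs Ys P X Y" and n: "1 \<le> n" and \<delta>: "0 < \<delta>"
  obtains G where "G \<in> sets M" "1 - \<delta> \<le> measure M G"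
    "\<And>\<omega>. \<omega> \<in> G \<Longrightarrow> eigenbasis.close_data J lam v \<beta>
        (\<sigma> * sqrt (2 * (\<integral>\<omega>. (norm (X \<omega>))\<^sup>2 \<partial>P)) * (real n * \<delta>) powr (-1/2))
        (sqrt (2 * (\<integral>\<omega>. norm (X \<omega>) ^ 4 \<partial>P)) * (real n * \<delta>) powr (-1/2))
        n (\<lambda>i. Xs i \<omega>) (\<lambda>i. Ys i \<omega>)"
proof -
  interpret eigenbasis J lam v by fact
  interpret P: prob_space P by fact
  interpret M: prob_space M by fact
  define E2 where "E2 = (\<integral>\<omega>. (norm (X \<omega>))\<^sup>2 \<partial>P)"
  define E4 where "E4 = (\<integral>\<omega>. norm (X \<omega>) ^ 4 \<partial>P)"
  define N where "N = real n * \<delta>"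
  have N: "0 < N" using n \<delta> by (simp add: N_def)
  have pw: "(N powr (-1/2))\<^sup>2 = 1 / N"
    using N by (simp add: power2_eq_square powr_add[symmetric] powr_minus_divide)
  define W where "W i \<omega> = (Xs i \<omega>, Ys i \<omega>)" for i \<omega>
  define V where "V \<omega> = (X \<omega>, Y \<omega>)" for \<omega>
  have ind: "M.indep_vars (\<lambda>_. borel) W {1..n}"
    and copies: "\<And>i. i \<in> {1..n} \<Longrightarrow> distr M borel (W i) = distr P borel V"
    using iid unfolding iid_copies_def W_def[abs_def] V_def[abs_def] by auto
  have Ym: "Y \<in> borel_measurable P"
    by (subst measurable_cong[OF Y]) simp_all
  have V: "V \<in> borel_measurable P" unfolding V_def using X Ym by (rule borel_measurable_Pair)
  have W: "W i \<in> borel_measurable M" if "i \<in> {1..n}" for i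
    using ind that by (auto simp: M.indep_vars_def2)
  have Xm: "Xs i \<in> borel_measurable M" if "i \<in> {1..n}" for i
    using measurable_compose[OF W[OF that], of fst borel] by (simp add: W_def borel_measurable_continuous_onI continuous_on_fst)
  have Ysm: "Ys i \<in> borel_measurable M" if "i \<in> {1..n}" for i
    using measurable_compose[OF W[OF that], of snd borel] by (simp add: W_def borel_measurable_continuous_onI continuous_on_snd)

  define f where "f p = (snd p - \<beta> \<bullet> fst p) *\<^sub>R fst p" for p :: "'a \<times> real"
  have fm: "f \<in> borel_measurable borel"
    unfolding f_def by (intro borel_measurable_continuous_onI continuous_intros)
  have fV: "f (V \<omega>) = eps \<omega> *\<^sub>R X \<omega>" if "\<omega> \<in> space P" for \<omega>
    using Y[OF that] by (simp add: f_def V_def)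
  note noise = conditional_variance_moment_bound[OF P X eps sq cond_var]
  have fsq: "integrable P (\<lambda>\<omega>. (norm (f (V \<omega>)))\<^sup>2)"
    using noise(1) by (subst Bochner_Integration.integrable_cong[OF refl, of P _ "\<lambda>\<omega>. (norm (eps \<omega> *\<^sub>R X \<omega>))\<^sup>2"]) (auto simp: fV)
  have fmean: "(\<integral>\<omega>. f (V \<omega>) \<partial>P) = 0"
    using eps_X by (subst Bochner_Integration.integral_cong[OF refl fV]) auto
  have fle: "(\<integral>\<omega>. (norm (f (V \<omega>)))\<^sup>2 \<partial>P) \<le> \<sigma>\<^sup>2 * E2"
    unfolding E2_def using noise(2)
    by (subst Bochner_Integration.integral_cong[OF refl, of P _ "\<lambda>\<omega>. (norm (eps \<omega> *\<^sub>R X \<omega>))\<^sup>2"]) (auto simp: fV)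
  define xi where "xi \<omega> = emp_r n (\<lambda>i. Xs i \<omega>) (\<lambda>i. Ys i \<omega>) - emp_K n (\<lambda>i. Xs i \<omega>) \<beta>" for \<omega>
  have xi: "xi \<omega> = (1 / real n) *\<^sub>R (\<Sum>i=1..n. f (W i \<omega>))" for \<omega>
    by (simp add: xi_def emp_r_def emp_K_def rank_one_def f_def W_def scaleR_diff_right[symmetric]
        sum_subtractf[symmetric] scaleR_diff_left inner_commute)
  define D2 where "D2 = \<sigma>\<^sup>2 * (2 * E2) / N"
  have D2: "0 < D2" using pos2 sigma N by (simp add: D2_def E2_def)
  have bad1: "measure M {\<omega> \<in> space M. D2 < (norm (xi \<omega>))\<^sup>2} \<le> \<delta> / 2"
  proof (rule markov_exceedance[OF M])
    note mom = iid_mean_second_moment[OF M P ind copies V fm fsq fmean n]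
    show "integrable M (\<lambda>\<omega>. (norm (xi \<omega>))\<^sup>2)" unfolding xi by (rule mom(1))
    have "(\<integral>\<omega>. (norm (xi \<omega>))\<^sup>2 \<partial>M) = (\<integral>\<omega>. (norm (f (V \<omega>)))\<^sup>2 \<partial>P) / real n"
      unfolding xi by (rule mom(2))
    also have "\<dots> \<le> \<sigma>\<^sup>2 * E2 / real n"
      using fle by (intro divide_right_mono) auto
    also have "\<dots> = D2 * (\<delta> / 2)" using n \<delta> by (simp add: D2_def N_def field_simps)
    finally show "(\<integral>\<omega>. (norm (xi \<omega>))\<^sup>2 \<partial>M) \<le> D2 * (\<delta> / 2)" .
  qed (use D2 in auto)

  define H where "H K \<omega> = (\<Sum>j\<in>J \<inter> {..K}. (norm (emp_K n (\<lambda>i. Xs i \<omega>) (v j) - lam j *\<^sub>R v j))\<^sup>2)" for K :: nat and \<omega>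
  define g where "g j p = rank_one (fst p) (v j) - lam j *\<^sub>R v j" for j and p :: "'a \<times> real"
  have gm: "g j \<in> borel_measurable borel" for j
    unfolding g_def rank_one_def by (intro borel_measurable_continuous_onI continuous_intros)
  have r_le: "(norm (rank_one (X \<omega>) b))\<^sup>2 \<le> (norm b)\<^sup>2 * norm (X \<omega>) ^ 4" for \<omega> b
  proof -
    have "\<bar>X \<omega> \<bullet> b\<bar> * norm (X \<omega>) \<le> (norm (X \<omega>) * norm b) * norm (X \<omega>)"
      by (intro mult_right_mono Cauchy_Schwarz_ineq2) auto
    hence "(\<bar>X \<omega> \<bullet> b\<bar> * norm (X \<omega>))\<^sup>2 \<le> ((norm (X \<omega>) * norm b) * norm (X \<omega>))\<^sup>2"
      by (intro power_mono) auto
    thus ?thesis by (simp add: rank_one_def power_mult_distrib mult_ac power2_eq_square power4_eq_xxxx)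
  qed
  have rm[measurable]: "(\<lambda>\<omega>. rank_one (X \<omega>) b) \<in> borel_measurable P" for b
    unfolding rank_one_def by simp
  have rsq: "integrable P (\<lambda>\<omega>. (norm (rank_one (X \<omega>) b))\<^sup>2)" for b
    by (rule Bochner_Integration.integrable_bound[of P "\<lambda>\<omega>. (norm b)\<^sup>2 * norm (X \<omega>) ^ 4"])
      (use moment_X r_le in auto)
  have gV: "g j (V \<omega>) = rank_one (X \<omega>) (v j) - lam j *\<^sub>R v j" for j \<omega> by (simp add: g_def V_def)
  have rmean: "(\<integral>\<omega>. rank_one (X \<omega>) (v j) \<partial>P) = lam j *\<^sub>R v j" if "j \<in> J" for j
    using cov[OF that] by (simp add: cov_op_def)
  have emp: "emp_K n (\<lambda>i. Xs i \<omega>) (v j) - lam j *\<^sub>R v j = (1 / real n) *\<^sub>R (\<Sum>i=1..n. g j (W i \<omega>))" for j \<omega>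
    using n by (simp add: emp_K_def g_def W_def sum_subtractf scaleR_diff_right sum_constant_scaleR)
  have Hj: "integrable M (\<lambda>\<omega>. (norm (emp_K n (\<lambda>i. Xs i \<omega>) (v j) - lam j *\<^sub>R v j))\<^sup>2)"
      "(\<integral>\<omega>. (norm (emp_K n (\<lambda>i. Xs i \<omega>) (v j) - lam j *\<^sub>R v j))\<^sup>2 \<partial>M)
        \<le> (\<integral>\<omega>. (norm (rank_one (X \<omega>) (v j)))\<^sup>2 \<partial>P) / real n"
    if "j \<in> J" for j
  proof -
    note cent = centered_second_moment_le[OF P rm rsq rmean[OF that]]
    have gsq: "integrable P (\<lambda>\<omega>. (norm (g j (V \<omega>)))\<^sup>2)" unfolding gV by (rule cent(1))
    have gmean: "(\<integral>\<omega>. g j (V \<omega>) \<partial>P) = 0" unfolding gV by (rule cent(2))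
    note mom = iid_mean_second_moment[OF M P ind copies V gm gsq gmean n]
    show "integrable M (\<lambda>\<omega>. (norm (emp_K n (\<lambda>i. Xs i \<omega>) (v j) - lam j *\<^sub>R v j))\<^sup>2)"
      unfolding emp by (rule mom(1))
    have "(\<integral>\<omega>. (norm (emp_K n (\<lambda>i. Xs i \<omega>) (v j) - lam j *\<^sub>R v j))\<^sup>2 \<partial>M)
        = (\<integral>\<omega>. (norm (g j (V \<omega>)))\<^sup>2 \<partial>P) / real n"
      unfolding emp by (rule mom(2))
    also have "\<dots> \<le> (\<integral>\<omega>. (norm (rank_one (X \<omega>) (v j)))\<^sup>2 \<partial>P) / real n"
      unfolding gV by (intro divide_right_mono cent(3)) simp
    finally show "(\<integral>\<omega>. (norm (emp_K n (\<lambda>i. Xs i \<omega>) (v j) - lam j *\<^sub>R v j))\<^sup>2 \<partial>M)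
        \<le> (\<integral>\<omega>. (norm (rank_one (X \<omega>) (v j)))\<^sup>2 \<partial>P) / real n" .
  qed
  have Hint: "integrable M (H K)" for K
    unfolding H_def using Hj(1) by (intro Bochner_Integration.integrable_sum) auto
  have Hle: "(\<integral>\<omega>. H K \<omega> \<partial>M) \<le> E4 / real n" for K
  proof -
    have "(\<integral>\<omega>. H K \<omega> \<partial>M) = (\<Sum>j\<in>J \<inter> {..K}. (\<integral>\<omega>. (norm (emp_K n (\<lambda>i. Xs i \<omega>) (v j) - lam j *\<^sub>R v j))\<^sup>2 \<partial>M))"
      unfolding H_def using Hj(1) by (intro Bochner_Integration.integral_sum) auto
    also have "\<dots> \<le> (\<Sum>j\<in>J \<inter> {..K}. (\<integral>\<omega>. (norm (rank_one (X \<omega>) (v j)))\<^sup>2 \<partial>P) / real n)"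
      using Hj(2) by (intro sum_mono) auto
    also have "\<dots> = (\<integral>\<omega>. (\<Sum>j\<in>J \<inter> {..K}. (norm (rank_one (X \<omega>) (v j)))\<^sup>2) \<partial>P) / real n"
      using rsq by (simp add: sum_divide_distrib[symmetric] Bochner_Integration.integral_sum)
    also have "\<dots> \<le> E4 / real n"
      unfolding E4_def
    proof (intro divide_right_mono integral_mono)
      fix \<omega>
      have "(\<Sum>j\<in>J \<inter> {..K}. (norm (rank_one (X \<omega>) (v j)))\<^sup>2) = (\<Sum>j\<in>J \<inter> {..K}. (v j \<bullet> X \<omega>)\<^sup>2) * (norm (X \<omega>))\<^sup>2"
        by (simp add: rank_one_def power_mult_distrib sum_distrib_right inner_commute)
      also have "\<dots> \<le> (norm (X \<omega>))\<^sup>2 * (norm (X \<omega>))\<^sup>2"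
        by (intro mult_right_mono bessel) (use orth in auto)
      also have "\<dots> = norm (X \<omega>) ^ 4" by (simp add: power2_eq_square power4_eq_xxxx)
      finally show "(\<Sum>j\<in>J \<inter> {..K}. (norm (rank_one (X \<omega>) (v j)))\<^sup>2) \<le> norm (X \<omega>) ^ 4" .
    qed (use rsq moment_X in auto)
    finally show ?thesis .
  qed
  define B2 where "B2 = 2 * E4 / N"
  have B2: "0 < B2" using pos4 N by (simp add: B2_def E4_def)
  have bad2K: "measure M {\<omega> \<in> space M. B2 < H K \<omega>} \<le> \<delta> / 2" for K
  proof (rule markov_exceedance[OF M Hint])
    have "E4 / real n = B2 * (\<delta> / 2)" using n \<delta> by (simp add: B2_def N_def field_simps)
    thus "(\<integral>\<omega>. H K \<omega> \<partial>M) \<le> B2 * (\<delta> / 2)" using Hle[of K] by (simp only:)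
  qed (use B2 in \<open>auto simp: H_def sum_nonneg\<close>)
  have Hm[measurable]: "H K \<in> borel_measurable M" for K using Hint by simp
  have H_mono: "H K \<omega> \<le> H K' \<omega>" if "K \<le> K'" for K K' \<omega>
    unfolding H_def using that by (intro sum_mono2) auto
  have bad2: "measure M (\<Union>K. {\<omega> \<in> space M. B2 < H K \<omega>}) \<le> \<delta> / 2"
  proof (rule LIMSEQ_le_const2)
    show "(\<lambda>K. measure M {\<omega> \<in> space M. B2 < H K \<omega>}) \<longlonglongrightarrow> measure M (\<Union>K. {\<omega> \<in> space M. B2 < H K \<omega>})"
      by (intro M.finite_Lim_measure_incseq)
        (auto simp: incseq_def intro: less_le_trans[OF _ H_mono])
  qed (use bad2K in auto)

  have xim[measurable]: "xi \<in> borel_measurable M"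
    unfolding xi_def by (intro borel_measurable_diff measurable_emp_r measurable_emp_K Xm Ysm borel_measurable_const)
  \<comment> \<open>the exceptional event, of probability at most \<open>\<delta>/2 + \<delta>/2\<close>\<close>
  define Bad where "Bad = {\<omega> \<in> space M. D2 < (norm (xi \<omega>))\<^sup>2} \<union> (\<Union>K. {\<omega> \<in> space M. B2 < H K \<omega>})"
  have Bm: "Bad \<in> sets M" unfolding Bad_def by measurable
  have "measure M Bad \<le> \<delta> / 2 + \<delta> / 2"
    unfolding Bad_def by (rule order_trans[OF measure_Un_le add_mono[OF bad1 bad2]]) measurable
  hence "1 - \<delta> \<le> measure M (space M - Bad)" using M.prob_compl[OF Bm] by simp
  moreover have "space M - Bad \<in> sets M" using Bm by auto
  moreover have "close_data \<beta> (\<sigma> * sqrt (2 * E2) * N powr (-1/2)) (sqrt (2 * E4) * N powr (-1/2))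
      n (\<lambda>i. Xs i \<omega>) (\<lambda>i. Ys i \<omega>)" if \<omega>: "\<omega> \<in> space M - Bad" for \<omega>
    unfolding close_data_def
  proof (intro conjI allI impI)
    have "(norm (xi \<omega>))\<^sup>2 \<le> D2" using \<omega> by (auto simp: Bad_def not_less)
    also have "D2 = (\<sigma> * sqrt (2 * E2) * N powr (-1/2))\<^sup>2"
      using pos2 unfolding power_mult_distrib pw by (simp add: D2_def E2_def)
    finally show "norm (emp_r n (\<lambda>i. Xs i \<omega>) (\<lambda>i. Ys i \<omega>) - emp_K n (\<lambda>i. Xs i \<omega>) \<beta>) \<le> \<sigma> * sqrt (2 * E2) * N powr (-1/2)"
      unfolding xi_def by (rule power2_le_imp_le) (use sigma pos2 in \<open>simp add: E2_def\<close>)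
    fix F assume F: "finite F" "F \<subseteq> J"
    have "(\<Sum>j\<in>F. (norm (emp_K n (\<lambda>i. Xs i \<omega>) (v j) - lam j *\<^sub>R v j))\<^sup>2) \<le> H (Max (insert 0 F)) \<omega>"
      unfolding H_def using F by (intro sum_mono2) auto
    also have "\<dots> \<le> B2" using \<omega> by (auto simp: Bad_def not_less)
    also have "B2 = (sqrt (2 * E4) * N powr (-1/2))\<^sup>2"
      using pos4 unfolding power_mult_distrib pw by (simp add: B2_def E4_def)
    finally show "(\<Sum>j\<in>F. (norm (emp_K n (\<lambda>i. Xs i \<omega>) (v j) - lam j *\<^sub>R v j))\<^sup>2) \<le> (sqrt (2 * E4) * N powr (-1/2))\<^sup>2" .
  qed
  ultimately show ?thesis using that unfolding E2_def E4_def N_def by blast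
qed

theorem theorem5:
  fixes P :: "'p measure"
    and X :: "'p \<Rightarrow> 'a::{real_inner,banach,second_countable_topology}"
    and Y eps :: "'p \<Rightarrow> real"
    and \<beta> :: 'a
    and J :: "nat set" and lam :: "nat \<Rightarrow> real" and v :: "nat \<Rightarrow> 'a"
    and \<sigma> \<mu> R C \<tau> :: real
  assumes P: "prob_space P"
    and X: "X \<in> borel_measurable P"
    and eps: "eps \<in> borel_measurable P"
    and Y: "\<And>\<omega>. \<omega> \<in> space P \<Longrightarrow> Y \<omega> = \<beta> \<bullet> X \<omega> + eps \<omega>"
    and eps_X: "(\<integral>\<omega>. eps \<omega> *\<^sub>R X \<omega> \<partial>P) = 0"
    and mean_X: "(\<integral>\<omega>. X \<omega> \<partial>P) = 0"
    and moment_X: "integrable P (\<lambda>\<omega>. norm (X \<omega>) ^ 4)"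
    and sigma: "0 < \<sigma>"
    and cond_var: "AE \<omega> in P. nn_cond_exp P (vimage_algebra (space P) X borel)
                      (\<lambda>\<omega>. ennreal ((eps \<omega>)\<^sup>2)) \<omega> \<le> ennreal (\<sigma>\<^sup>2)"
    and decomp: "spectral_decomp (cov_op P X) J lam v"
    and no_zero: "\<not> is_eigenvalue (cov_op P X) 0"
    and params: "1 \<le> \<mu>" "0 < R" "0 < C"
    and source: "(\<lambda>j. (\<beta> \<bullet> v j)\<^sup>2 / lam j powr (2 * \<mu>)) summable_on J"
                "(\<Sum>\<^sub>\<infinity>j\<in>J. (\<beta> \<bullet> v j)\<^sup>2 / lam j powr (2 * \<mu>)) \<le> R\<^sup>2"
    and trace: "lam summable_on J" "(\<Sum>\<^sub>\<infinity>j\<in>J. lam j) \<le> C"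
    and tau: "1 < \<tau>"
  shows "\<exists>c1 c2 :: real \<Rightarrow> real.
    \<forall>(n::nat) (\<delta>::real) (M::'b measure) Xs Ys.
      prob_space M \<longrightarrow> iid_copies M n Xs Ys P X Y \<longrightarrow>
      1 \<le> n \<longrightarrow> 0 < \<delta> \<longrightarrow> \<delta> < 1 \<longrightarrow> exp 1 / real n \<le> \<delta> \<longrightarrow>
      (let m_hat = (\<lambda>\<omega>. pls_stop n (\<lambda>i. Xs i \<omega>) (\<lambda>i. Ys i \<omega>)
              (\<tau> * \<sigma> * sqrt (2 * (\<integral>\<omega>'. (norm (X \<omega>'))\<^sup>2 \<partial>P) / (\<delta> * real n))))
       in measure M {\<omega> \<in> space M.
            (\<forall>\<kappa>>0. lam \<in> O(\<lambda>j. real j powr (- 2 * \<kappa>)) \<longrightarrow>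
               real (m_hat \<omega>) \<le> c1 \<kappa> * (real n * \<delta>) powr (1 / (4 * (\<kappa> + 1) * (\<mu> + 1)))) \<and>
            (\<forall>q. 0 < q \<and> q < 1 \<and> lam \<in> O(\<lambda>j. q ^ j) \<longrightarrow>
               real (m_hat \<omega>) \<le> c2 q * ln (real n * \<delta>))} \<ge> 1 - \<delta>)"
proof -
  interpret P: prob_space P by fact
  note [measurable] = X eps
  define E2 where "E2 = (\<integral>\<omega>. (norm (X \<omega>))\<^sup>2 \<partial>P)"
  define E4 where "E4 = (\<integral>\<omega>. norm (X \<omega>) ^ 4 \<partial>P)"
  have sq: "integrable P (\<lambda>\<omega>. (norm (X \<omega>))\<^sup>2)"
  proof (rule integrable_of_square_integrable)
    show "integrable P (\<lambda>\<omega>. (norm ((norm (X \<omega>))\<^sup>2))\<^sup>2)" using moment_X by simp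
  qed (use P.finite_measure_axioms in auto)
  note eb = spectral_decomp_eigenbasis[OF decomp no_zero]
  show ?thesis
  proof (cases "AE \<omega> in P. X \<omega> = 0")
    case True
    \<comment> \<open>then \<open>K = 0\<close>, which is injective only on the trivial space\<close>
    have zero: "b = 0" for b :: 'a
    proof (rule ccontr)
      assume "b \<noteq> 0"
      have "cov_op P X b = (\<integral>\<omega>. 0 \<partial>P)"
        unfolding cov_op_def by (rule integral_cong_AE) (use True in \<open>auto simp: rank_one_def\<close>)
      hence "cov_op P X b = 0 *\<^sub>R b" by simp
      thus False using no_zero \<open>b \<noteq> 0\<close> by (auto simp: is_eigenvalue_def)
    qed
    have stop0: "pls_stop n x y (\<tau> * \<sigma> * sqrt (2 * (\<integral>\<omega>'. (norm (X \<omega>'))\<^sup>2 \<partial>P) / (\<delta> * real n))) = 0"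
      if "0 < \<delta>" for n \<delta> and x :: "nat \<Rightarrow> 'a" and y
    proof -
      have "0 \<le> \<tau> * \<sigma> * sqrt (2 * (\<integral>\<omega>'. (norm (X \<omega>'))\<^sup>2 \<partial>P) / (\<delta> * real n))"
        using tau sigma that by (intro mult_nonneg_nonneg real_sqrt_ge_zero divide_nonneg_nonneg) auto
      hence "pls_stop n x y (\<tau> * \<sigma> * sqrt (2 * (\<integral>\<omega>'. (norm (X \<omega>'))\<^sup>2 \<partial>P) / (\<delta> * real n))) \<le> 0"
        using zero[of "emp_r n x y - emp_K n x (pls n x y 0)"] by (intro pls_stop_le) (metis norm_zero)
      thus ?thesis by simp
    qed
    show ?thesis
      by (rule exI[of _ "\<lambda>_. 0"], rule exI[of _ "\<lambda>_. 0"]) (auto simp: stop0 prob_space.prob_space)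
  next
    case False
    have pos: "0 < E2" "0 < E4"
    proof -
      have "E2 \<noteq> 0" "E4 \<noteq> 0"
        unfolding E2_def E4_def using False moment_X sq
        by (subst integral_nonneg_eq_0_iff_AE; simp)+
      moreover have "0 \<le> E2" "0 \<le> E4" by (simp_all add: E2_def E4_def)
      ultimately show "0 < E2" "0 < E4" by auto
    qed
    define D0 where "D0 = \<sigma> * sqrt (2 * E2)"
    define B0 where "B0 = sqrt (2 * E4)"
    interpret eigenbasis J lam v by (rule eb(1))
    interpret source_condition J lam v \<beta> \<mu> R C \<tau> D0 B0
    proof
      show "lam j \<le> C" if "j \<in> J" for j
        using finite_sum_le_infsum[OF trace(1), of "{j}"] that lam_pos trace(2) by (force dest: less_imp_le)
      show "(\<Sum>j\<in>F. (\<beta> \<bullet> v j)\<^sup>2 / lam j powr (2 * \<mu>)) \<le> R\<^sup>2" if "finite F" "F \<subseteq> J" for F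
        using finite_sum_le_infsum[OF source(1) that] source(2) by (force intro: order_trans)
      show "0 < D0" "0 \<le> B0" using pos sigma by (auto simp: D0_def B0_def)
    qed (use params tau in auto)
    have "\<forall>\<kappa>. \<exists>c. 0 < \<kappa> \<and> lam \<in> O(\<lambda>j. real j powr (- 2 * \<kappa>)) \<longrightarrow>
      (\<forall>N n x y. 1 \<le> N \<longrightarrow> close_data \<beta> (D0 * N powr (-1/2)) (B0 * N powr (-1/2)) n x y \<longrightarrow>
        real (pls_stop n x y (\<tau> * (D0 * N powr (-1/2)))) \<le> c * N powr (1 / (4 * (\<kappa> + 1) * (\<mu> + 1))))"
      using polynomial_rate by blast
    then obtain c1 where c1: "\<And>\<kappa> N n x y. 0 < \<kappa> \<Longrightarrow> lam \<in> O(\<lambda>j. real j powr (- 2 * \<kappa>)) \<Longrightarrow> 1 \<le> N \<Longrightarrow>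
        close_data \<beta> (D0 * N powr (-1/2)) (B0 * N powr (-1/2)) n x y \<Longrightarrow>
        real (pls_stop n x y (\<tau> * (D0 * N powr (-1/2)))) \<le> c1 \<kappa> * N powr (1 / (4 * (\<kappa> + 1) * (\<mu> + 1)))"
      unfolding choice_iff by blast
    have "\<forall>q. \<exists>c. 0 < q \<and> q < 1 \<and> lam \<in> O(\<lambda>j. q ^ j) \<longrightarrow>
      (\<forall>N n x y. exp 1 \<le> N \<longrightarrow> close_data \<beta> (D0 * N powr (-1/2)) (B0 * N powr (-1/2)) n x y \<longrightarrow>
        real (pls_stop n x y (\<tau> * (D0 * N powr (-1/2)))) \<le> c * ln N)"
      using exponential_rate by blast
    then obtain c2 where c2: "\<And>q N n x y. 0 < q \<Longrightarrow> q < 1 \<Longrightarrow> lam \<in> O(\<lambda>j. q ^ j) \<Longrightarrow> exp 1 \<le> N \<Longrightarrow>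
        close_data \<beta> (D0 * N powr (-1/2)) (B0 * N powr (-1/2)) n x y \<Longrightarrow>
        real (pls_stop n x y (\<tau> * (D0 * N powr (-1/2)))) \<le> c2 q * ln N"
      unfolding choice_iff by blast
    show ?thesis
      unfolding Let_def
    proof (rule exI[of _ c1], rule exI[of _ c2], intro allI impI)
      fix n :: nat and \<delta> :: real and M :: "'b measure" and Xs Ys
      assume M: "prob_space M" and iid: "iid_copies M n Xs Ys P X Y" and n: "1 \<le> n"
        and \<delta>: "0 < \<delta>" "\<delta> < 1" "exp 1 / real n \<le> \<delta>"
      interpret M: prob_space M by fact
      define N where "N = real n * \<delta>"
      have N: "exp 1 \<le> N" using \<delta>(3) n by (simp add: N_def pos_divide_le_eq mult.commute)
      hence N1: "1 \<le> N" using one_le_exp_iff[of "1::real"] by linarith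
      have t: "\<tau> * \<sigma> * sqrt (2 * (\<integral>\<omega>'. (norm (X \<omega>'))\<^sup>2 \<partial>P) / (\<delta> * real n)) = \<tau> * (D0 * N powr (-1/2))"
        using N1 by (simp add: D0_def E2_def[symmetric] N_def real_sqrt_divide powr_minus_divide powr_half_sqrt mult.commute)
      obtain G where G: "G \<in> sets M" "1 - \<delta> \<le> measure M G"
          "\<And>\<omega>. \<omega> \<in> G \<Longrightarrow> close_data \<beta> (D0 * N powr (-1/2)) (B0 * N powr (-1/2)) n (\<lambda>i. Xs i \<omega>) (\<lambda>i. Ys i \<omega>)"
        using close_data_event[OF eb(1) P M X eps Y eps_X moment_X sq sigma cond_var eb(2) pos[unfolded E2_def E4_def] iid n \<delta>(1)]
        unfolding D0_def B0_def E2_def E4_def N_def by blast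
      let ?m = "\<lambda>\<omega>. pls_stop n (\<lambda>i. Xs i \<omega>) (\<lambda>i. Ys i \<omega>) (\<tau> * (D0 * N powr (-1/2)))"
      \<comment> \<open>The event is the preimage under the stopping index of a set of natural numbers, hence measurable.\<close>
      define Ok where "Ok = {m::nat. (\<forall>\<kappa>>0. lam \<in> O(\<lambda>j. real j powr (- 2 * \<kappa>)) \<longrightarrow>
               real m \<le> c1 \<kappa> * (real n * \<delta>) powr (1 / (4 * (\<kappa> + 1) * (\<mu> + 1)))) \<and>
            (\<forall>q. 0 < q \<and> q < 1 \<and> lam \<in> O(\<lambda>j. q ^ j) \<longrightarrow> real m \<le> c2 q * ln (real n * \<delta>))}"
      have W: "(\<lambda>\<omega>. (Xs i \<omega>, Ys i \<omega>)) \<in> borel_measurable M" if "i \<in> {1..n}" for i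
        using iid that by (auto simp: iid_copies_def M.indep_vars_def2)
      have "?m \<in> measurable M (count_space UNIV)"
      proof (rule measurable_pls_stop)
        show "Xs i \<in> borel_measurable M" if "i \<in> {1..n}" for i
          using measurable_compose[OF W[OF that], of fst borel] by (simp add: borel_measurable_continuous_onI continuous_on_fst)
        show "Ys i \<in> borel_measurable M" if "i \<in> {1..n}" for i
          using measurable_compose[OF W[OF that], of snd borel] by (simp add: borel_measurable_continuous_onI continuous_on_snd)
      qed
      hence meas: "?m -` Ok \<inter> space M \<in> sets M" by (rule measurable_sets) simp
      have "G \<subseteq> ?m -` Ok \<inter> space M"
      proof
        fix \<omega> assume \<omega>: "\<omega> \<in> G"
        show "\<omega> \<in> ?m -` Ok \<inter> space M"
          using c1[OF _ _ N1 G(3)[OF \<omega>]] c2[OF _ _ _ N G(3)[OF \<omega>]] sets.sets_into_space[OF G(1)] \<omega>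
          unfolding Ok_def N_def by blast
      qed
      hence "measure M G \<le> measure M (?m -` Ok \<inter> space M)" by (rule M.finite_measure_mono[OF _ meas])
      with G(2) have "1 - \<delta> \<le> measure M (?m -` Ok \<inter> space M)" by (rule order_trans)
      also have "?m -` Ok \<inter> space M = {\<omega> \<in> space M. ?m \<omega> \<in> Ok}" by auto
      finally show "1 - \<delta> \<le> measure M {\<omega> \<in> space M.
            (\<forall>\<kappa>>0. lam \<in> O(\<lambda>j. real j powr (- 2 * \<kappa>)) \<longrightarrow>
               real (pls_stop n (\<lambda>i. Xs i \<omega>) (\<lambda>i. Ys i \<omega>)
              (\<tau> * \<sigma> * sqrt (2 * (\<integral>\<omega>'. (norm (X \<omega>'))\<^sup>2 \<partial>P) / (\<delta> * real n)))) \<le> c1 \<kappa> * (real n * \<delta>) powr (1 / (4 * (\<kappa> + 1) * (\<mu> + 1)))) \<and>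
            (\<forall>q. 0 < q \<and> q < 1 \<and> lam \<in> O(\<lambda>j. q ^ j) \<longrightarrow>
               real (pls_stop n (\<lambda>i. Xs i \<omega>) (\<lambda>i. Ys i \<omega>)
              (\<tau> * \<sigma> * sqrt (2 * (\<integral>\<omega>'. (norm (X \<omega>'))\<^sup>2 \<partial>P) / (\<delta> * real n)))) \<le> c2 q * ln (real n * \<delta>))}"
        unfolding t Ok_def mem_Collect_eq .
    qed
  qed
qed

end
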